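(* Let $V$, $\Delta$, $W$, $P$, $Q$, $n$ and the notations below be as in the context. For $\mathbf{k}=(k_\alpha)_{\alpha\in\Delta_+}\in\mathbb{N}_{\geq2}^{n}$, $\mathbf{y}\in V$ and $f\in\mathfrak{F}(P/Q)$, $$\sum_{w\in W}\Bigl(\prod_{\alpha\in\Delta_+\cap w\Delta_-}(-1)^{k_{\alpha}}\Bigr)\zeta_r(w^{-1}\mathbf{k},w^{-1}\mathbf{y},f;\Delta)=(-1)^{n}\biggl(\prod_{\alpha\in\Delta_+}\frac{(2\pi\sqrt{-1})^{k_\alpha}}{k_\alpha!}\biggr)\mathcal{P}(\mathbf{k},\mathbf{y},f;\Delta).$$
   Context: $V$ is an $r$-dimensional real inner product space $\langle\cdot,\cdot\rangle$, identified with its dual. $\Delta\subset V$ is a finite reduced root system (not necessarily irreducible) with fundamental system $\Psi=\{\alpha_1,\dots,\alpha_r\}$, positive roots $\Delta_+$, negative roots $\Delta_-=-\Delta_+$, $n=|\Delta_+|$. For $\alpha\in\Delta$, $\alpha^\vee=2\alpha/\langle\alpha,\alpha\rangle$. Fundamental weights $\lambda_j$: $\langle\alpha_i^\vee,\lambda_j\rangle=\delta_{ij}$; fundamental coweights $\lambda_j^\vee$: $\langle\lambda_i^\vee,\alpha_j\rangle=\delta_{ij}$. $Q=\bigoplus\mathbb{Z}\alpha_i$, $Q^\vee=\bigoplus\mathbb{Z}\alpha_i^\vee$, $P=\bigoplus\mathbb{Z}\lambda_i$, $P^\vee=\bigoplus\mathbb{Z}\lambda_i^\vee$, $P_{++}=\bigoplus\mathbb{N}\lambda_i$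 ($\mathbb{N}=\{1,2,\dots\}$, $\mathbb{N}_{\ge 2}=\{2,3,\dots\}$). $W$ is the Weyl group, generated by the reflections $\sigma_\alpha(v)=v-\langle\alpha^\vee,v\rangle\alpha$. $\mathfrak{F}(P/Q)$ is the set of complex functions on $P$ constant on cosets of $Q$; for such $f$ and $\mu\in P^\vee$, $\widehat f(\mu)=\frac{1}{|P/Q|}\sum_{\lambda\in P/Q}f(\lambda)e^{-2\pi i\langle\mu,\lambda\rangle}$ (depending only on $\mu$ mod $Q^\vee$). For $\mathbf{s}=(s_\alpha)_{\alpha\in\Delta_+}\in\mathbb{C}^n$, $\mathbf{y}\in V$: $\zeta_r(\mathbf{s},\mathbf{y},f;\Delta)=\sum_{\lambda\in P_{++}}f(\lambda)e^{2\pi i\langle\mathbf{y},\lambda\rangle}\prod_{\alpha\in\Delta_+}\langle\alpha^\vee,\lambda\rangle^{-s_\alpha}$. For $w\in W$, $w^{-1}\mathbf{s}=(s_{w\alpha})_{\alpha\in\Delta_+}$, where if $w\alpha\in\Delta_-$ the index $w\alpha$ is identified with $-w\alpha\in\Delta_+$; $w^{-1}\mathbf{y}$ is the usual action of $W$ on $V$. Let $B_k(x)$ be the Bernoulli polynomials ($te^{xt}/(e^t-1)=\sum_k B_k(x)t^k/k!$) and $\{x\}=x-\lfloor x\rfloor$. For $\mathbf{k}\in\mathbb{N}_0^n$ and $\mathbf{y}\in V$, $$\mathcal{P}(\mathbf{k},\mathbf{y};\Delta)=\int_0^1\!\!\cdots\!\int_0^1\Bigl(\prod_{\alpha\in\Delta_+\setminus\Psi}B_{k_\alpha}(x_\alpha)\Bigr)\prod_{i=1}^rB_{k_{\alpha_i}}\Bigl(\Bigl\{\langle\mathbf{y},\lambda_i\rangle-\sum_{\alpha\in\Delta_+\setminus\Psi}x_\alpha\langle\alpha^\vee,\lambda_i\rangle\Bigr\}\Bigr)\prod_{\alpha\in\Delta_+\setminus\Psi}dx_\alpha,$$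 and $\mathcal{P}(\mathbf{k},\mathbf{y},f;\Delta)=\sum_{\mu\in P^\vee/Q^\vee}\widehat f(\mu)\mathcal{P}(\mathbf{k},\mathbf{y}+\mu;\Delta)$. *)

theory Defs
  imports
    "HOL-Analysis.Analysis"
    "HOL-Computational_Algebra.Formal_Power_Series"
    "HOL-Algebra.Bij"
    "HOL-Algebra.Generated_Groups"
begin

definition coroot :: "'a::euclidean_space \<Rightarrow> 'a" where
  "coroot \<alpha> = (2 / (\<alpha> \<bullet> \<alpha>)) *\<^sub>R \<alpha>"

definition root_reflection :: "'a::euclidean_space \<Rightarrow> 'a \<Rightarrow> 'a" where
  "root_reflection \<alpha> v = v - (coroot \<alpha> \<bullet> v) *\<^sub>R \<alpha>"

definition reduced_root_system :: "'a::euclidean_space set \<Rightarrow> bool" where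
  "reduced_root_system \<Delta> \<longleftrightarrow>
     finite \<Delta> \<and> 0 \<notin> \<Delta> \<and> span \<Delta> = UNIV \<and>
     (\<forall>\<alpha>\<in>\<Delta>. root_reflection \<alpha> ` \<Delta> = \<Delta>) \<and>
     (\<forall>\<alpha>\<in>\<Delta>. \<forall>\<beta>\<in>\<Delta>. coroot \<alpha> \<bullet> \<beta> \<in> \<int>) \<and>
     (\<forall>\<alpha>\<in>\<Delta>. \<forall>c. c *\<^sub>R \<alpha> \<in> \<Delta> \<longrightarrow> c = 1 \<or> c = -1)"

text \<open>
  The simple roots serve as their own indices: a family indexed by $1,\dots,r$
  is a function on the set $\Psi$ of simple roots.
\<close>

definition positive_roots :: "'a::euclidean_space set \<Rightarrow> 'a set \<Rightarrow> 'a set" where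
  "positive_roots \<Delta> \<Psi> = {\<alpha> \<in> \<Delta>. \<exists>c :: 'a \<Rightarrow> nat. \<alpha> = (\<Sum>\<beta>\<in>\<Psi>. real (c \<beta>) *\<^sub>R \<beta>)}"

definition negative_roots :: "'a::euclidean_space set \<Rightarrow> 'a set \<Rightarrow> 'a set" where
  "negative_roots \<Delta> \<Psi> = uminus ` positive_roots \<Delta> \<Psi>"

definition fundamental_system :: "'a::euclidean_space set \<Rightarrow> 'a set \<Rightarrow> bool" where
  "fundamental_system \<Delta> \<Psi> \<longleftrightarrow>
     \<Psi> \<subseteq> \<Delta> \<and> independent \<Psi> \<and> span \<Psi> = UNIV \<and>
     \<Delta> = positive_roots \<Delta> \<Psi> \<union> negative_roots \<Delta> \<Psi>"

definition fundamental_weight :: "'a::euclidean_space set \<Rightarrow> 'a \<Rightarrow> 'a" where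
  "fundamental_weight \<Psi> \<beta> =
     (THE v. \<forall>\<alpha>\<in>\<Psi>. coroot \<alpha> \<bullet> v = (if \<alpha> = \<beta> then 1 else 0))"

definition fundamental_coweight :: "'a::euclidean_space set \<Rightarrow> 'a \<Rightarrow> 'a" where
  "fundamental_coweight \<Psi> \<beta> =
     (THE v. \<forall>\<alpha>\<in>\<Psi>. v \<bullet> \<alpha> = (if \<alpha> = \<beta> then 1 else 0))"

definition int_span :: "'a::euclidean_space set \<Rightarrow> ('a \<Rightarrow> 'a) \<Rightarrow> 'a set" where
  "int_span \<Psi> b = {\<Sum>\<alpha>\<in>\<Psi>. of_int (c \<alpha>) *\<^sub>R b \<alpha> | c :: 'a \<Rightarrow> int. True}"

definition root_lattice :: "'a::euclidean_space set \<Rightarrow> 'a set" where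
  "root_lattice \<Psi> = int_span \<Psi> (\<lambda>\<alpha>. \<alpha>)"

definition coroot_lattice :: "'a::euclidean_space set \<Rightarrow> 'a set" where
  "coroot_lattice \<Psi> = int_span \<Psi> coroot"

definition weight_lattice :: "'a::euclidean_space set \<Rightarrow> 'a set" where
  "weight_lattice \<Psi> = int_span \<Psi> (fundamental_weight \<Psi>)"

definition coweight_lattice :: "'a::euclidean_space set \<Rightarrow> 'a set" where
  "coweight_lattice \<Psi> = int_span \<Psi> (fundamental_coweight \<Psi>)"

definition strictly_dominant_weights :: "'a::euclidean_space set \<Rightarrow> 'a set" where
  "strictly_dominant_weights \<Psi> =
     {\<Sum>\<alpha>\<in>\<Psi>. real (m \<alpha>) *\<^sub>R fundamental_weight \<Psi> \<alpha> | m :: 'a \<Rightarrow> nat. \<forall>\<alpha>\<in>\<Psi>. m \<alpha> \<ge> 1}"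

definition weyl_group :: "'a::euclidean_space set \<Rightarrow> ('a \<Rightarrow> 'a) set" where
  "weyl_group \<Delta> = generate (BijGroup UNIV) (root_reflection ` \<Delta>)"

definition cosets :: "'a::euclidean_space set \<Rightarrow> 'a set \<Rightarrow> 'a set set" where
  "cosets L M = L // {(x, y). x \<in> L \<and> y \<in> L \<and> x - y \<in> M}"

text \<open>Below, summands depending only on a coset are evaluated at a chosen representative.\<close>

definition coset_rep :: "'a set \<Rightarrow> 'a" where
  "coset_rep C = (SOME x. x \<in> C)"

text \<open>
  Values of \<open>f\<close> outside the weight lattice are irrelevant: nothing below depends on them.
\<close>

definition weight_class_functions :: "'a::euclidean_space set \<Rightarrow> ('a \<Rightarrow> complex) set" where
  "weight_class_functions \<Psi> =
     {f. \<forall>\<nu>\<in>weight_lattice \<Psi>. \<forall>\<mu>\<in>weight_lattice \<Psi>. \<nu> - \<mu> \<in> root_lattice \<Psi> \<longrightarrow> f \<nu> = f \<mu>}"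

definition weight_fourier :: "'a::euclidean_space set \<Rightarrow> ('a \<Rightarrow> complex) \<Rightarrow> 'a \<Rightarrow> complex" where
  "weight_fourier \<Psi> f \<mu> =
     1 / of_nat (card (cosets (weight_lattice \<Psi>) (root_lattice \<Psi>))) *
     (\<Sum>C\<in>cosets (weight_lattice \<Psi>) (root_lattice \<Psi>).
        f (coset_rep C) * exp (- 2 * of_real pi * \<i> * of_real (\<mu> \<bullet> coset_rep C)))"

definition root_zeta ::
  "'a::euclidean_space set \<Rightarrow> 'a set \<Rightarrow> ('a \<Rightarrow> complex) \<Rightarrow> 'a \<Rightarrow> ('a \<Rightarrow> complex) \<Rightarrow> complex" where
  "root_zeta \<Delta> \<Psi> s y f =
     (\<Sum>\<^sub>\<infinity>\<nu>\<in>strictly_dominant_weights \<Psi>.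
        f \<nu> * exp (2 * of_real pi * \<i> * of_real (y \<bullet> \<nu>)) *
        (\<Prod>\<alpha>\<in>positive_roots \<Delta> \<Psi>. of_real (coroot \<alpha> \<bullet> \<nu>) powr (- s \<alpha>)))"

text \<open>
  \<open>weyl_inv_act \<Delta> \<Psi> w s\<close> is $w^{-1}\mathbf{s} = (s_{w\alpha})_\alpha$, where a negative
  index is identified with its positive opposite.
\<close>

definition weyl_inv_act ::
  "'a::euclidean_space set \<Rightarrow> 'a set \<Rightarrow> ('a \<Rightarrow> 'a) \<Rightarrow> ('a \<Rightarrow> 'b) \<Rightarrow> 'a \<Rightarrow> 'b" where
  "weyl_inv_act \<Delta> \<Psi> w s \<alpha> =
     (if w \<alpha> \<in> negative_roots \<Delta> \<Psi> then s (- w \<alpha>) else s (w \<alpha>))"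

text \<open>
  The division of power series below is exact: the denominator has subdegree 1.
\<close>

definition bernoulli_poly :: "nat \<Rightarrow> real \<Rightarrow> real" where
  "bernoulli_poly k x = fact k * fps_nth (fps_X * fps_exp x / (fps_exp 1 - 1)) k"

definition root_bernoulli ::
  "'a::euclidean_space set \<Rightarrow> 'a set \<Rightarrow> ('a \<Rightarrow> nat) \<Rightarrow> 'a \<Rightarrow> real" where
  "root_bernoulli \<Delta> \<Psi> k y =
     (let I = positive_roots \<Delta> \<Psi> - \<Psi> in
      LINT x : (\<Pi>\<^sub>E \<alpha>\<in>I. {0..1}) | (\<Pi>\<^sub>M \<alpha>\<in>I. lborel).
        (\<Prod>\<alpha>\<in>I. bernoulli_poly (k \<alpha>) (x \<alpha>)) *
        (\<Prod>\<beta>\<in>\<Psi>. bernoulli_poly (k \<beta>)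
           (frac (y \<bullet> fundamental_weight \<Psi> \<beta> -
                  (\<Sum>\<alpha>\<in>I. x \<alpha> * (coroot \<alpha> \<bullet> fundamental_weight \<Psi> \<beta>))))))"

definition root_bernoulli_twisted ::
  "'a::euclidean_space set \<Rightarrow> 'a set \<Rightarrow> ('a \<Rightarrow> nat) \<Rightarrow> 'a \<Rightarrow> ('a \<Rightarrow> complex) \<Rightarrow> complex" where
  "root_bernoulli_twisted \<Delta> \<Psi> k y f =
     (\<Sum>C\<in>cosets (coweight_lattice \<Psi>) (coroot_lattice \<Psi>).
        weight_fourier \<Psi> f (coset_rep C) * of_real (root_bernoulli \<Delta> \<Psi> k (y + coset_rep C)))"

end

theory Submission
  imports Defs
begin

text \<open>
  Both sides equal the absolutely convergent sum
  \[ \sum_{\nu \in P} f(\nu)\, e^{2\pi i\langle y,\nu\rangle}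
       \prod_{\alpha\in\Delta_+} \langle\alpha^\vee,\nu\rangle^{-k_\alpha}, \]
  where singular weights contribute \<open>0\<close>.
  On the zeta side, the Weyl group acts simply transitively on the chambers, so every regular weight
  is \<open>w \<nu>\<close> for exactly one \<open>w\<close> and one strictly dominant \<open>\<nu>\<close>; moreover \<open>w \<nu> - \<nu>\<close> lies in the root
  lattice, and moving \<open>w\<close> through the product produces precisely the signs in the statement.
  On the Bernoulli side, each factor of a simple root is replaced by its Fourier series
  \[ B_k(\{x\}) = -\frac{k!}{(2\pi i)^k} \sum_{m\ne 0} \frac{e^{2\pi i m x}}{m^k}, \]
  after which the integral splits into Fourier coefficients of the remaining Bernoulli polynomials;
  the twist by \<open>f\<close> is removed by Fourier inversion on the finite group \<open>P / Q\<close>, whose dual is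
  the group of coweights modulo coroots.
\<close>

section \<open>Bernoulli polynomials\<close>

text \<open>The bound 2 on the exponents is spent twice: it gives B_k(0) = B_k(1), so that B_k({x})
  is continuous and determined by its Fourier coefficients, and it makes those coefficients
  absolutely summable, so that the series may be multiplied together and integrated termwise. Only
  the factors with a fractional part are expanded. The factor B_k(x_\<alpha>) of a nonsimple root
  stays a polynomial on [0,1]: after the expansion x_\<alpha> occurs in the phase with frequency
  -<\<alpha>^vee, \<nu>>, so integrating it out produces exactly the missing factor <\<alpha>^vee,
  \<nu>>^(-k). At frequency 0 this coefficient is 0, which is why the convention 1 / 0 = 0 handles
  singular weights without a case split. Each positive root contributes one constant -k! / (2 pi
  i)^k; together these are inverse to the constant of the statement, and their minus signs make up
  (-1)^n. Fourier inversion needs |P/Q| = |P^vee/Q^vee|, because the transform is normalised by the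
  first index while the twist sums over the second group.\<close>

definition e2pi :: "real \<Rightarrow> complex" where
  "e2pi x = exp (2 * of_real pi * \<i> * of_real x)"

lemma e2pi_add: "e2pi (x + y) = e2pi x * e2pi y"
  by (simp add: e2pi_def exp_add algebra_simps)

lemma e2pi_0 [simp]: "e2pi 0 = 1"
  by (simp add: e2pi_def)

lemma e2pi_sum: "finite A \<Longrightarrow> e2pi (\<Sum>i\<in>A. g i) = (\<Prod>i\<in>A. e2pi (g i))"
  by (induction A rule: finite_induct) (auto simp: e2pi_add)

lemma e2pi_eq_cis: "e2pi x = cis (2 * pi * x)"
  by (simp add: e2pi_def cis_conv_exp algebra_simps)

lemma norm_e2pi [simp]: "norm (e2pi x) = 1"
  by (simp add: e2pi_eq_cis)

lemma e2pi_eq_1_iff: "e2pi x = 1 \<longleftrightarrow> x \<in> \<int>"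
proof -
  have "e2pi x = 1 \<longleftrightarrow> (\<exists>n::int. 2 * pi * x = of_int (2 * n) * pi)"
    by (simp add: e2pi_def exp_eq_1)
  also have "\<dots> \<longleftrightarrow> (\<exists>n::int. x = of_int n)"
    by (intro ex_cong1) (auto simp: field_simps)
  finally show ?thesis by (auto simp: Ints_def)
qed

lemma e2pi_of_int [simp]: "e2pi (of_int n) = 1"
  by (simp add: e2pi_eq_1_iff)

lemma e2pi_cong_int: "x - y \<in> \<int> \<Longrightarrow> e2pi x = e2pi y"
  using e2pi_add[of "x - y" y] by (simp add: e2pi_eq_1_iff[symmetric])

lemma continuous_on_e2pi [continuous_intros]:
  "continuous_on A g \<Longrightarrow> continuous_on A (\<lambda>x. e2pi (g x))"
  unfolding e2pi_def by (intro continuous_intros)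

lemma has_vector_derivative_e2pi:
  "((\<lambda>x. e2pi (c * x)) has_vector_derivative 2 * of_real pi * \<i> * c * e2pi (c * x)) (at x within A)"
proof -
  have "((\<lambda>z. exp (2 * of_real pi * \<i> * (of_real c * z))) has_field_derivative
      2 * of_real pi * \<i> * of_real c * exp (2 * of_real pi * \<i> * (of_real c * of_real x))) (at (of_real x))"
    by (auto intro!: derivative_eq_intros)
  from has_vector_derivative_real_field[OF this, of A] show ?thesis
    by (simp add: e2pi_def)
qed

lemma integral_e2pi:
  "integral {0..1} (\<lambda>x. e2pi (of_int m * x)) = (if m = 0 then 1 else 0)"
proof (cases "m = 0")
  case False
  have "((\<lambda>x. 2 * of_real pi * \<i> * of_int m * e2pi (of_int m * x)) has_integral
      e2pi (of_int m * 1) - e2pi (of_int m * 0)) {0..1}"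
    using has_vector_derivative_e2pi[of "of_int m"]
    by (intro fundamental_theorem_of_calculus) auto
  hence "((\<lambda>x. 2 * of_real pi * \<i> * of_int m * e2pi (of_int m * x)) has_integral 0) {0..1}"
    by simp
  from has_integral_mult_right[OF this, of "1 / (2 * of_real pi * \<i> * of_int m)"]
  have "((\<lambda>x. e2pi (of_int m * x)) has_integral 0) {0..1}"
    using False by simp
  thus ?thesis using False by (simp add: integral_unique)
qed auto

section \<open>Generating function, derivatives and Fourier coefficients of the Bernoulli
  polynomials\<close>

definition bernoulli_gf :: "real fps" where
  "bernoulli_gf = fps_X / (fps_exp 1 - 1)"

lemma bernoulli_gf_mult: "bernoulli_gf * (fps_exp 1 - 1) = fps_X"
proof -
  have "fps_nth (fps_exp 1 - 1 :: real fps) 1 \<noteq> 0" "fps_nth (fps_exp 1 - 1 :: real fps) 0 = 0"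
    by simp_all
  hence "subdegree (fps_exp 1 - 1 :: real fps) = 1"
    by (intro subdegreeI) auto
  hence "(fps_exp 1 - 1 :: real fps) dvd fps_X"
    by (subst fps_dvd_iff) auto
  thus ?thesis by (simp add: bernoulli_gf_def)
qed

text \<open>Pulling the exponential out of the quotient leaves a product with the generating
  function of the Bernoulli numbers, so \<open>bernoulli_poly\<close> becomes a Cauchy product, that
  is, an explicit polynomial in \<open>x\<close>.\<close>

lemma bernoulli_gf_exp: "fps_X * fps_exp x / (fps_exp 1 - 1) = bernoulli_gf * fps_exp x"
proof -
  have "fps_exp 1 - 1 \<noteq> (0 :: real fps)"
    using bernoulli_gf_mult by auto
  moreover have "fps_X * fps_exp x = bernoulli_gf * fps_exp x * (fps_exp 1 - 1)"
    by (simp add: bernoulli_gf_mult[symmetric] mult_ac)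
  ultimately show ?thesis
    by (metis nonzero_mult_div_cancel_right)
qed

lemma bernoulli_poly_altdef:
  "bernoulli_poly k x = (\<Sum>i\<le>k. fact k * fps_nth bernoulli_gf (k - i) * x ^ i / fact i)"
proof -
  have "bernoulli_poly k x = fact k * fps_nth (fps_exp x * bernoulli_gf) k"
    unfolding bernoulli_poly_def bernoulli_gf_exp by (simp add: mult.commute)
  thus ?thesis
    by (simp add: fps_mult_nth sum_distrib_left atLeast0AtMost) (simp add: mult_ac)
qed

lemma bernoulli_poly_0 [simp]: "bernoulli_poly 0 x = 1"
proof -
  have "fps_nth (bernoulli_gf * (fps_exp 1 - 1)) 1 = 1"
    by (simp add: bernoulli_gf_mult)
  thus ?thesis by (simp add: bernoulli_poly_altdef fps_mult_nth)
qed

lemma has_real_derivative_bernoulli_poly: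
  "(bernoulli_poly (Suc k) has_real_derivative real (Suc k) * bernoulli_poly k x) (at x)"
proof -
  define c where "c i = fact (Suc k) * fps_nth bernoulli_gf (Suc k - i) / fact i" for i
  have "((\<lambda>x. \<Sum>i\<le>Suc k. c i * x ^ i) has_real_derivative
      (\<Sum>i\<le>Suc k. c i * (real i * x ^ (i - 1)))) (at x)"
    by (intro derivative_eq_intros refl sum.cong) auto
  also have "(\<Sum>i\<le>Suc k. c i * (real i * x ^ (i - 1))) =
      (\<Sum>i\<le>k. c (Suc i) * (real (Suc i) * x ^ i))"
    by (subst sum.atMost_Suc_shift) simp
  also have "\<dots> = real (Suc k) * bernoulli_poly k x"
    unfolding bernoulli_poly_altdef sum_distrib_left
    by (intro sum.cong) (auto simp: c_def divide_simps simp del: of_nat_Suc)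
  finally show ?thesis
    by (simp add: bernoulli_poly_altdef[abs_def] c_def mult_ac)
qed

lemma continuous_on_bernoulli_poly [continuous_intros]:
  "continuous_on A g \<Longrightarrow> continuous_on A (\<lambda>x. bernoulli_poly k (g x))"
  unfolding bernoulli_poly_altdef by (intro continuous_intros) auto

lemma borel_measurable_bernoulli_poly [measurable]: "bernoulli_poly k \<in> borel_measurable borel"
  by (intro borel_measurable_continuous_onI continuous_intros)

text \<open>The factor exp(t) - 1 of the difference cancels the denominator and leaves t alone.
  Equal end values for k other than 1 make the periodic extension continuous; the jump at k = 1
  starts the recursion for the Fourier coefficients.\<close>

lemma bernoulli_poly_1_minus_0:
  "bernoulli_poly k 1 - bernoulli_poly k 0 = (if k = 1 then 1 else 0)"
proof -
  have "bernoulli_poly k 1 - bernoulli_poly k 0 = fact k * fps_nth (bernoulli_gf * (fps_exp 1 - 1)) k"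
    unfolding bernoulli_poly_def bernoulli_gf_exp by (simp add: algebra_simps)
  thus ?thesis by (simp add: bernoulli_gf_mult)
qed

lemma integral_bernoulli_poly: "integral {0..1} (bernoulli_poly k) = (if k = 0 then 1 else 0)"
proof -
  have "((\<lambda>x. real (Suc k) * bernoulli_poly k x) has_integral
      bernoulli_poly (Suc k) 1 - bernoulli_poly (Suc k) 0) {0..1}"
    using has_real_derivative_bernoulli_poly[of k]
    by (intro fundamental_theorem_of_calculus)
       (auto simp: has_real_derivative_iff_has_vector_derivative[symmetric] intro: DERIV_subset)
  from has_integral_mult_right[OF this, of "1 / real (Suc k)"]
  have "(bernoulli_poly k has_integral (if k = 0 then 1 else 0)) {0..1}"
    by (cases "k = 0") (simp_all add: bernoulli_poly_1_minus_0 bernoulli_poly_0[abs_def])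
  thus ?thesis by (rule integral_unique)
qed

text \<open>For \<open>m = 0\<close> the right-hand side is \<open>0\<close>, since \<open>1 / 0 ^ k = 0\<close>.\<close>

lemma bernoulli_poly_fourier_coeff:
  assumes "k \<ge> 1"
  shows "integral {0..1} (\<lambda>x. of_real (bernoulli_poly k x) * e2pi (- of_int m * x)) =
         - fact k / (2 * of_real pi * \<i>) ^ k * (1 / of_int m ^ k)"
proof (cases "m = 0")
  case True
  have "integral {0..1} (\<lambda>x. complex_of_real (bernoulli_poly k x)) =
      of_real (integral {0..1} (bernoulli_poly k))"
    by (intro integral_unique has_integral_of_real integrable_integral
          integrable_continuous_real continuous_intros)
  thus ?thesis using True assms by (simp add: integral_bernoulli_poly)
next
  case m: False
  define c where "c = - (2 * of_real pi * \<i> * of_int m)"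
  have c: "c \<noteq> 0" using m by (simp add: c_def)
  define J where "J k = integral {0..1} (\<lambda>x. of_real (bernoulli_poly k x) * e2pi (- of_int m * x))" for k
  have J0: "J 0 = 0"
    using integral_e2pi[of "-m"] m by (simp add: J_def)
  \<comment> \<open>Integration by parts against the character. The boundary term B_{k+1}(1) -
    B_{k+1}(0) survives only for k = 0, where it gives J 1 = 1 / c because J 0 = 0.\<close>
  have J_Suc: "(if k = 0 then 1 else 0) = of_nat (Suc k) * J k + c * J (Suc k)" for k
  proof -
    let ?B = "\<lambda>k x. complex_of_real (bernoulli_poly k x)"
    let ?e = "\<lambda>x. e2pi (- of_int m * x)"
    have "((\<lambda>x. ?B (Suc k) x * ?e x) has_vector_derivative
        ?B (Suc k) x * (c * ?e x) + (of_nat (Suc k) * ?B k x) * ?e x) (at x within {0..1})" for x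
    proof (rule has_vector_derivative_mult)
      have "(?B (Suc k) has_vector_derivative of_real (real (Suc k) * bernoulli_poly k x))
          (at x within {0..1})"
        by (intro has_vector_derivative_of_real)
           (use has_real_derivative_bernoulli_poly in
             \<open>auto simp: has_real_derivative_iff_has_vector_derivative[symmetric] intro: DERIV_subset\<close>)
      thus "(?B (Suc k) has_vector_derivative of_nat (Suc k) * ?B k x) (at x within {0..1})"
        by simp
      show "(?e has_vector_derivative c * ?e x) (at x within {0..1})"
        using has_vector_derivative_e2pi[of "- of_int m" x] by (simp add: c_def)
    qed
    hence "((\<lambda>x. ?B (Suc k) x * (c * ?e x) + (of_nat (Suc k) * ?B k x) * ?e x) has_integral
        ?B (Suc k) 1 * ?e 1 - ?B (Suc k) 0 * ?e 0) {0..1}"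
      by (intro fundamental_theorem_of_calculus) auto
    moreover have "?B (Suc k) 1 * ?e 1 - ?B (Suc k) 0 * ?e 0 = (if k = 0 then 1 else 0)"
    proof -
      have "?e 1 = 1" using e2pi_of_int[of "-m"] by simp
      thus ?thesis using bernoulli_poly_1_minus_0[of "Suc k"]
        by (auto simp flip: of_real_diff)
    qed
    moreover have "((\<lambda>x. c * (?B (Suc k) x * ?e x) + of_nat (Suc k) * (?B k x * ?e x)) has_integral
        c * J (Suc k) + of_nat (Suc k) * J k) {0..1}"
      unfolding J_def
      by (intro has_integral_add has_integral_mult_right integrable_integral
            integrable_continuous_real continuous_intros)
    moreover have "(\<lambda>x. ?B (Suc k) x * (c * ?e x) + (of_nat (Suc k) * ?B k x) * ?e x) =
        (\<lambda>x. c * (?B (Suc k) x * ?e x) + of_nat (Suc k) * (?B k x * ?e x))"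
      by (simp add: fun_eq_iff mult_ac)
    ultimately have "(if k = 0 then 1 else 0) = c * J (Suc k) + of_nat (Suc k) * J k"
      by (metis (no_types, lifting) has_integral_unique)
    thus ?thesis by (simp only: add.commute)
  qed
  have "J (Suc k) = - fact (Suc k) * (-1 / c) ^ Suc k" for k
  proof (induction k)
    case 0
    show ?case using J_Suc[of 0] J0 c by (simp add: field_simps)
  next
    case (Suc k)
    have "c * J (Suc (Suc k)) = - of_nat (Suc (Suc k)) * J (Suc k)"
      using J_Suc[of "Suc k"] by (simp add: eq_neg_iff_add_eq_0 algebra_simps)
    hence "J (Suc (Suc k)) = - of_nat (Suc (Suc k)) * J (Suc k) / c"
      using c by (simp add: field_simps)
    thus ?case unfolding Suc.IH fact_Suc[of "Suc k"] power_Suc[of _ "Suc k"]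
      by (simp del: fact_Suc of_nat_Suc power_Suc)
  qed
  moreover obtain k' where "k = Suc k'" using assms by (cases k) auto
  moreover have "(-1 / c) ^ k = 1 / (2 * of_real pi * \<i>) ^ k * (1 / of_int m ^ k)"
    by (simp add: c_def power_divide power_mult_distrib)
  ultimately have "J k = - fact k * (1 / (2 * of_real pi * \<i>) ^ k * (1 / of_int m ^ k))"
    by metis
  thus ?thesis by (simp add: J_def)
qed

section \<open>Fourier expansion of the Bernoulli polynomials\<close>

text \<open>
  The set of continuous functions on the unit interval all of whose Fourier coefficients vanish
  is closed under multiplication by polynomials in the real and imaginary part of
  \<open>e2pi x\<close>; this makes the polynomial approximation theorem on the circle applicable.
\<close>

definition fourier_null :: "(real \<Rightarrow> complex) \<Rightarrow> bool" where
  "fourier_null h \<longleftrightarrow> continuous_on {0..1} h \<and>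
     (\<forall>m::int. ((\<lambda>x. h x * e2pi (of_int m * x)) has_integral 0) {0..1})"

lemma fourier_null_add:
  assumes "fourier_null g" "fourier_null h"
  shows "fourier_null (\<lambda>x. g x + h x)"
  unfolding fourier_null_def
proof (intro conjI allI)
  show "continuous_on {0..1} (\<lambda>x. g x + h x)"
    using assms unfolding fourier_null_def by (auto intro!: continuous_intros)
  show "((\<lambda>x. (g x + h x) * e2pi (of_int m * x)) has_integral 0) {0..1}" for m
    using assms has_integral_add[of "\<lambda>x. g x * e2pi (of_int m * x)" 0 "{0..1}" "\<lambda>x. h x * e2pi (of_int m * x)" 0]
    by (simp add: distrib_right fourier_null_def)
qed

lemma fourier_null_cmult:
  assumes "fourier_null h"
  shows "fourier_null (\<lambda>x. c * h x)"
  unfolding fourier_null_def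
proof (intro conjI allI)
  show "continuous_on {0..1} (\<lambda>x. c * h x)"
    using assms unfolding fourier_null_def by (auto intro!: continuous_intros)
  show "((\<lambda>x. c * h x * e2pi (of_int m * x)) has_integral 0) {0..1}" for m
    using assms has_integral_mult_right[of "\<lambda>x. h x * e2pi (of_int m * x)" 0 "{0..1}" c]
    by (simp add: mult.assoc fourier_null_def)
qed

text \<open>Multiplication by a character only shifts the frequency. Cosine and sine then follow as
  combinations of the frequencies 1 and -1.\<close>

lemma fourier_null_e2pi:
  assumes "fourier_null h"
  shows "fourier_null (\<lambda>x. h x * e2pi (of_int n * x))"
proof -
  have "((\<lambda>x. h x * e2pi (of_int n * x) * e2pi (of_int m * x)) has_integral 0) {0..1}" for m
  proof -
    have "((\<lambda>x. h x * e2pi (of_int (n + m) * x)) has_integral 0) {0..1}"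
      using assms unfolding fourier_null_def by blast
    thus ?thesis by (simp add: distrib_right e2pi_add mult.assoc)
  qed
  thus ?thesis using assms unfolding fourier_null_def
    by (auto intro!: continuous_intros)
qed

lemma fourier_null_Re:
  assumes "fourier_null h"
  shows "fourier_null (\<lambda>x. h x * of_real (Re (e2pi x)))"
proof -
  have "h x * of_real (Re (e2pi x)) =
      (1/2) * (h x * e2pi (of_int 1 * x) + h x * e2pi (of_int (-1) * x))" for x
    by (simp add: e2pi_eq_cis complex_eq_iff)
  thus ?thesis
    using assms by (simp only:) (intro fourier_null_cmult fourier_null_add fourier_null_e2pi)
qed

lemma fourier_null_Im:
  assumes "fourier_null h"
  shows "fourier_null (\<lambda>x. h x * of_real (Im (e2pi x)))"
proof -
  have "h x * of_real (Im (e2pi x)) =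
      (-\<i>/2) * (h x * e2pi (of_int 1 * x) + (-1) * (h x * e2pi (of_int (-1) * x)))" for x
    by (simp add: e2pi_eq_cis complex_eq_iff)
  thus ?thesis
    using assms by (simp only:) (intro fourier_null_cmult fourier_null_add fourier_null_e2pi)
qed

text \<open>The induction keeps \<open>h\<close> arbitrary: in the product case the second
  hypothesis is applied to \<open>h\<close> already multiplied by the first factor. In the linear
  case, a real-linear functional on the complex plane is a combination of real and imaginary
  part.\<close>

lemma fourier_null_real_polynomial:
  assumes "real_polynomial_function q" "fourier_null h"
  shows "fourier_null (\<lambda>x. h x * of_real (q (e2pi x)))"
  using assms
proof (induction q arbitrary: h rule: real_polynomial_function.induct)
  case (linear f)
  interpret bounded_linear f by fact
  have f: "f z = Re z * f 1 + Im z * f \<i>" for z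
  proof -
    have "f z = f (Re z *\<^sub>R 1 + Im z *\<^sub>R \<i>)"
      by (rule arg_cong[of _ _ f]) (simp add: complex_eq_iff)
    thus ?thesis by (simp add: add scaleR)
  qed
  have "(\<lambda>x. h x * of_real (f (e2pi x))) = (\<lambda>x. of_real (f 1) * (h x * of_real (Re (e2pi x)))
      + of_real (f \<i>) * (h x * of_real (Im (e2pi x))))"
    by (rule ext, subst f) (simp add: algebra_simps)
  moreover have "fourier_null \<dots>"
    by (intro fourier_null_cmult fourier_null_add fourier_null_Re fourier_null_Im linear.prems)
  ultimately show ?case by (simp only:)
next
  case (const c)
  thus ?case using fourier_null_cmult[of h "of_real c"] by (simp add: mult.commute)
next
  case (add f g)
  thus ?case using fourier_null_add[OF add.IH(1)[OF add.prems] add.IH(2)[OF add.prems]]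
    by (simp add: algebra_simps)
next
  case (mult f g)
  thus ?case using mult.IH(2)[OF mult.IH(1)[OF mult.prems]]
    by (simp add: mult.assoc)
qed

lemma fourier_null_polynomial:
  assumes "polynomial_function p" "fourier_null h"
  shows "fourier_null (\<lambda>x. h x * p (e2pi x))"
proof -
  have "real_polynomial_function (Re \<circ> p)" "real_polynomial_function (Im \<circ> p)"
    using assms(1) bounded_linear_Re bounded_linear_Im unfolding polynomial_function_def by blast+
  from this[THEN fourier_null_real_polynomial[OF _ assms(2)]]
  have "fourier_null (\<lambda>x. h x * of_real (Re (p (e2pi x))) + \<i> * (h x * of_real (Im (p (e2pi x)))))"
    by (intro fourier_null_add fourier_null_cmult) (auto simp: o_def)
  moreover have "h x * of_real (Re (p (e2pi x))) + \<i> * (h x * of_real (Im (p (e2pi x)))) =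
      h x * p (e2pi x)" for x
    by (simp add: complex_eq_iff)
  ultimately show ?thesis by simp
qed

text \<open>Equal end values let \<open>h\<close> descend to the circle. The section
  \<open>Arg2pi z / (2 * pi)\<close> jumps at 1, so continuity is read off the graph instead: it is
  the image of the compact interval under a continuous curve, hence closed, and \<open>g\<close>
  takes values in a compact set.\<close>

lemma continuous_circle_lift:
  fixes h :: "real \<Rightarrow> complex"
  assumes "continuous_on {0..1} h" "h 0 = h 1"
  obtains g where "continuous_on (sphere 0 1) g" "\<And>t. t \<in> {0..1} \<Longrightarrow> g (e2pi t) = h t"
proof
  define g where "g z = h (Arg2pi z / (2 * pi))" for z
  show g: "g (e2pi t) = h t" if "t \<in> {0..1}" for t
  proof (cases "t = 1")
    case True
    thus ?thesis using assms(2) e2pi_of_int[of 1] by (simp add: g_def Arg2pi_of_real[of 1, simplified])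
  next
    case False
    have "Arg2pi (e2pi t) = 2 * pi * t"
      by (rule Arg2pi_unique[of 1]) (use that False in \<open>auto simp: e2pi_def mult_ac\<close>)
    thus ?thesis by (simp add: g_def)
  qed
  have img: "\<exists>t\<in>{0..1}. z = e2pi t" if "z \<in> sphere 0 1" for z
    using that Arg2pi[of z] by (intro bexI[of _ "Arg2pi z / (2 * pi)"]) (auto simp: e2pi_def mult_ac is_Arg_def)
  show "continuous_on (sphere 0 1) g"
  proof (rule continuous_from_closed_graph)
    show "compact (h ` {0..1})"
      using assms by (intro compact_continuous_image) auto
    show "g \<in> sphere 0 1 \<rightarrow> h ` {0..1}"
      using img g by force
    have "(\<lambda>z. (z, g z)) ` sphere 0 1 = (\<lambda>t. (e2pi t, h t)) ` {0..1}"
      using img g by (force simp: image_iff)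
    also have "compact \<dots>"
      using assms by (intro compact_continuous_image continuous_intros) auto
    finally show "closed ((\<lambda>z. (z, g z)) ` sphere 0 1)"
      by (rule compact_imp_closed)
  qed
qed

text \<open>The conjugate of \<open>h\<close>, lifted to the circle, is uniformly within
  \<open>e\<close> of a polynomial. As \<open>h\<close> times that polynomial integrates to 0, the
  integral of |h|^2 is at most \<open>B * e\<close> for every positive \<open>e\<close>.\<close>

lemma fourier_null_imp_zero:
  assumes null: "fourier_null h" and h01: "h 0 = h 1" and x: "x \<in> {0..1}"
  shows "h x = 0"
proof -
  have cont: "continuous_on {0..1} h"
    using null by (simp add: fourier_null_def)
  obtain g where g: "continuous_on (sphere 0 1) g" "\<And>t. t \<in> {0..1} \<Longrightarrow> g (e2pi t) = cnj (h t)"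
    using continuous_circle_lift[of "\<lambda>t. cnj (h t)"] cont h01 by (auto intro: continuous_intros)
  obtain B where B: "\<And>t. t \<in> {0..1} \<Longrightarrow> norm (h t) \<le> B"
    using compact_imp_bounded[OF compact_continuous_image[OF cont]] by (force simp: bounded_iff)
  define J where "J = integral {0..1} (\<lambda>t. h t * cnj (h t))"
  have J: "((\<lambda>t. h t * cnj (h t)) has_integral J) {0..1}"
    unfolding J_def using cont
    by (intro integrable_integral integrable_continuous_real continuous_intros)
  have B0: "B \<ge> 0" using B[of 0] by (simp add: order_trans[OF norm_ge_zero])
  have "norm J \<le> B * e" if e: "e > 0" for e
  proof -
    obtain p where p: "polynomial_function p" "\<And>z. z \<in> sphere 0 1 \<Longrightarrow> norm (g z - p z) < e"
      using Stone_Weierstrass_polynomial_function[OF compact_sphere g(1) e] by blast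
    have "((\<lambda>t. h t * p (e2pi t) * e2pi (of_int 0 * t)) has_integral 0) {0..1}"
      using fourier_null_polynomial[OF p(1) null] unfolding fourier_null_def by blast
    from has_integral_diff[OF J this]
    have "((\<lambda>t. h t * cnj (h t) - h t * p (e2pi t)) has_integral J) {0..1}" by simp
    hence "norm J \<le> (B * e) * measure lborel (cbox 0 (1::real))"
      unfolding cbox_interval[symmetric]
    proof (rule has_integral_bound[rotated])
      show "0 \<le> B * e" using B0 e by simp
      fix t :: real assume "t \<in> cbox 0 1"
      hence t: "t \<in> {0..1}" by simp
      have "norm (h t * cnj (h t) - h t * p (e2pi t)) = norm (h t) * norm (g (e2pi t) - p (e2pi t))"
        using g(2)[OF t] by (simp add: norm_mult[symmetric] algebra_simps)
      also have "\<dots> \<le> B * e"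
        using B[OF t] p(2)[of "e2pi t"] B0 e by (intro mult_mono) auto
      finally show "norm (h t * cnj (h t) - h t * p (e2pi t)) \<le> B * e" .
    qed
    thus ?thesis by simp
  qed
  note J_le = this
  have "norm J \<le> \<epsilon>" if "\<epsilon> > 0" for \<epsilon>
  proof -
    \<comment> \<open>Dividing by \<open>B + 1\<close> keeps the choice of error positive and well
      defined even when \<open>B\<close> is 0.\<close>
    have "norm J \<le> B * (\<epsilon> / (B + 1))" using J_le[of "\<epsilon> / (B + 1)"] that B0 by simp
    also have "\<dots> \<le> \<epsilon>" using B0 that by (simp add: field_simps)
    finally show ?thesis .
  qed
  hence "J = 0" using field_le_epsilon[of "norm J" 0] by simp
  hence "((\<lambda>t. Re (h t * cnj (h t))) has_integral 0) {0..1}"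
    using has_integral_Re[OF J] by simp
  hence "integral {0..1} (\<lambda>t. (norm (h t))\<^sup>2) = 0"
    by (simp add: integral_unique complex_mult_cnj cmod_power2)
  hence "\<forall>t\<in>{0..1}. (norm (h t))\<^sup>2 = 0"
    by (subst (asm) integral_eq_0_iff) (auto intro!: continuous_intros cont)
  thus ?thesis using x by simp
qed

section \<open>Absolutely convergent Fourier series of the Bernoulli polynomials\<close>

lemma summable_on_int_inverse_power:
  assumes "k \<ge> 2"
  shows "(\<lambda>m::int. norm (1 / of_int m ^ k :: complex)) summable_on UNIV"
proof -
  let ?f = "\<lambda>m::int. norm (1 / of_int m ^ k :: complex)"
  have "summable (\<lambda>n. inverse (real n ^ k))"
    using inverse_power_summable[of k, where ?'a = real] assms by simp
  hence *: "(\<lambda>n. inverse (real n ^ k)) summable_on UNIV"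
    by (subst summable_on_UNIV_nonneg_real_iff) auto
  have "?f summable_on range int"
    using * by (subst summable_on_reindex) (auto simp: o_def norm_divide norm_power inverse_eq_divide)
  moreover have "?f summable_on range (\<lambda>n. - int n)"
    using * by (subst summable_on_reindex) (auto simp: o_def norm_divide norm_power inverse_eq_divide inj_def)
  ultimately have "?f summable_on (range int \<union> range (\<lambda>n. - int n))"
    by (rule summable_on_union)
  also have "range int \<union> range (\<lambda>n. - int n) = UNIV"
  proof -
    have "m \<in> range int \<union> range (\<lambda>n. - int n)" for m
      by (cases m rule: int_cases2) auto
    thus ?thesis by blast
  qed
  finally show ?thesis .
qed

text \<open>The series converges uniformly, so its sum \<open>S\<close> is continuous and has the
  coefficients \<open>c j\<close>. These are also the coefficients of the Bernoulli polynomial, so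
  the difference is annihilated by the uniqueness theorem.\<close>

lemma bernoulli_poly_fourier_aux:
  assumes k: "k \<ge> 2" and x: "x \<in> {0..1}"
  shows "((\<lambda>m::int. - fact k / (2 * of_real pi * \<i>) ^ k * (1 / of_int m ^ k) * e2pi (of_int m * x))
           has_sum of_real (bernoulli_poly k x)) UNIV"
proof -
  define c where "c m = - fact k / (2 * of_real pi * \<i>) ^ k * (1 / of_int m ^ k)" for m :: int
  define S where "S x = (\<Sum>\<^sub>\<infinity>m\<in>UNIV. c m * e2pi (of_int m * x))" for x
  have sum_c: "(\<lambda>m. norm (c m)) summable_on UNIV"
    using summable_on_cmult_right[OF summable_on_int_inverse_power[OF k], of "norm (fact k / (2 * of_real pi * \<i>) ^ k :: complex)"]
    by (simp add: c_def norm_mult norm_divide)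
  have unif: "uniform_limit A (\<lambda>F x. \<Sum>m\<in>F. c m * e2pi (of_int m * x)) S (finite_subsets_at_top UNIV)" for A
    unfolding S_def by (rule Weierstrass_m_test_general[OF _ sum_c]) (auto simp: norm_mult)
  have contS: "continuous_on A S" for A
    by (rule uniform_limit_theorem[OF _ unif]) (auto intro!: always_eventually continuous_intros)
  have coeffS: "((\<lambda>x. S x * e2pi (- of_int j * x)) has_integral c j) {0..1}" for j
  proof -
    have "uniform_limit {0..1} (\<lambda>F x. (\<Sum>m\<in>F. c m * e2pi (of_int m * x)) * e2pi (- of_int j * x))
        (\<lambda>x. S x * e2pi (- of_int j * x)) (finite_subsets_at_top UNIV)"
      by (intro uniform_lim_mult unif uniform_limit_const)
         (auto intro!: compact_imp_bounded compact_continuous_image contS continuous_intros)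
    then obtain I J where IJ:
      "\<And>F. ((\<lambda>x. (\<Sum>m\<in>F. c m * e2pi (of_int m * x)) * e2pi (- of_int j * x)) has_integral I F) {0..1}"
      "((\<lambda>x. S x * e2pi (- of_int j * x)) has_integral J) {0..1}"
      "(I \<longlongrightarrow> J) (finite_subsets_at_top UNIV)"
      by (rule uniform_limit_integral) (auto intro!: continuous_intros)
    \<comment> \<open>By orthogonality of the characters, the coefficient of every finite partial
      sum containing \<open>j\<close> is exactly \<open>c j\<close>, so the net \<open>I\<close> is
      eventually constant.\<close>
    have "eventually (\<lambda>F. c j = I F) (finite_subsets_at_top UNIV)"
      unfolding eventually_finite_subsets_at_top
    proof (intro exI[of _ "{j}"] conjI allI impI)
      fix F :: "int set" assume "finite F \<and> {j} \<subseteq> F \<and> F \<subseteq> UNIV"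
      hence F: "finite F" "j \<in> F" by auto
      have "((\<lambda>x. \<Sum>m\<in>F. c m * e2pi (of_int (m - j) * x)) has_integral
          (\<Sum>m\<in>F. c m * (if m - j = 0 then 1 else 0))) {0..1}"
        unfolding integral_e2pi[symmetric] using F
        by (intro has_integral_sum has_integral_mult_right integrable_integral
              integrable_continuous_real continuous_intros)
      also have "(\<Sum>m\<in>F. c m * (if m - j = 0 then 1 else 0)) = c j"
        using F by (simp add: if_distrib[of "\<lambda>x. _ * x"] cong: if_cong)
      also have "(\<lambda>x. \<Sum>m\<in>F. c m * e2pi (of_int (m - j) * x)) =
          (\<lambda>x. (\<Sum>m\<in>F. c m * e2pi (of_int m * x)) * e2pi (- of_int j * x))"
        by (simp add: fun_eq_iff sum_distrib_right mult.assoc flip: e2pi_add) (simp add: algebra_simps)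
      finally show "c j = I F" using IJ(1)[of F] by (rule has_integral_unique)
    qed auto
    hence "(I \<longlongrightarrow> c j) (finite_subsets_at_top UNIV)"
      by (rule Lim_transform_eventually[OF tendsto_const])
    hence "J = c j" using IJ(3) by (intro tendsto_unique[of _ I]) auto
    thus ?thesis using IJ(2) by simp
  qed
  define h where "h x = of_real (bernoulli_poly k x) - S x" for x
  have "fourier_null h"
    unfolding fourier_null_def
  proof (intro conjI allI)
    show "continuous_on {0..1} h"
      unfolding h_def by (intro continuous_intros contS)
    fix m :: int
    have "((\<lambda>x. of_real (bernoulli_poly k x) * e2pi (- of_int (-m) * x)) has_integral c (-m)) {0..1}"
      unfolding c_def using k
      by (subst bernoulli_poly_fourier_coeff[symmetric])
         (auto intro!: integrable_integral integrable_continuous_real continuous_intros)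
    from has_integral_diff[OF this coeffS[of "-m"]]
    show "((\<lambda>x. h x * e2pi (of_int m * x)) has_integral 0) {0..1}"
      by (simp add: h_def algebra_simps)
  qed
  \<comment> \<open>The uniqueness theorem lives on the circle, so the end values of both parts of
    \<open>h\<close> have to agree.\<close>
  moreover have "S 0 = S 1"
    unfolding S_def by (intro infsum_cong) simp
  hence "h 0 = h 1"
    using bernoulli_poly_1_minus_0[of k] k by (simp add: h_def)
  ultimately have "h x = 0"
    using x by (rule fourier_null_imp_zero)
  moreover have "((\<lambda>m. c m * e2pi (of_int m * x)) has_sum S x) UNIV"
    unfolding S_def
    by (rule has_sum_infsum, rule abs_summable_summable) (use sum_c in \<open>simp add: norm_mult\<close>)
  ultimately show ?thesis by (simp add: h_def c_def)
qed

lemma bernoulli_poly_frac_fourier: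
  assumes k: "k \<ge> 2"
  shows "((\<lambda>m::int. - fact k / (2 * of_real pi * \<i>) ^ k * (1 / of_int m ^ k) * e2pi (of_int m * x))
           has_sum of_real (bernoulli_poly k (frac x))) UNIV"
proof -
  have "e2pi (of_int m * frac x) = e2pi (of_int m * x)" for m
    by (rule e2pi_cong_int) (auto simp: frac_def algebra_simps simp flip: of_int_mult)
  thus ?thesis
    using bernoulli_poly_fourier_aux[OF k, of "frac x"] frac_lt_1[of x] by (simp add: less_imp_le)
qed

section \<open>Termwise integration over the unit cube\<close>

text \<open>The sum is a limit over the net of finite sets, so the exchange rests on an explicit
  tail estimate: the remainder after \<open>F\<close> is at most \<open>(T - sum N F) * w x\<close>,
  and integrating this bound leaves a quantity that tends to 0.\<close>

lemma has_sum_integral: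
  fixes g :: "'b \<Rightarrow> 'c \<Rightarrow> complex" and w :: "'c \<Rightarrow> real"
  assumes g: "\<And>m. m \<in> X \<Longrightarrow> integrable M (g m)" and w: "integrable M w"
    and bound: "\<And>m x. m \<in> X \<Longrightarrow> x \<in> space M \<Longrightarrow> norm (g m x) \<le> N m * w x"
    and N: "N summable_on X" and S [measurable]: "S \<in> borel_measurable M"
    and sum: "\<And>x. x \<in> space M \<Longrightarrow> ((\<lambda>m. g m x) has_sum S x) X"
  shows "((\<lambda>m. integral\<^sup>L M (g m)) has_sum integral\<^sup>L M S) X"
proof -
  define T where "T = infsum N X"
  have T: "(N has_sum T) X"
    unfolding T_def using N by (rule has_sum_infsum)
  have diff: "norm (S x - (\<Sum>m\<in>F. g m x)) \<le> (T - sum N F) * w x"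
    if "finite F" "F \<subseteq> X" "x \<in> space M" for F x
  proof (rule norm_infsum_le)
    show "((\<lambda>m. g m x) has_sum (S x - (\<Sum>m\<in>F. g m x))) (X - F)"
      using that by (intro has_sum_Diff sum has_sum_finite)
    show "((\<lambda>m. N m * w x) has_sum (T - sum N F) * w x) (X - F)"
      using that T by (intro has_sum_cmult_left has_sum_Diff has_sum_finite)
  qed (use bound that in auto)
  have intS: "integrable M S"
  proof (rule Bochner_Integration.integrable_bound)
    show "integrable M (\<lambda>x. T * w x)" using w by simp
    \<comment> \<open>The tail bound for the empty set dominates \<open>S\<close> itself.\<close>
    show "AE x in M. norm (S x) \<le> norm (T * w x)"
      using diff[of "{}"] by (intro AE_I2) (force intro: order_trans[OF _ abs_ge_self])
  qed simp
  have "norm (integral\<^sup>L M S - (\<Sum>m\<in>F. integral\<^sup>L M (g m))) \<le> (T - sum N F) * integral\<^sup>L M w"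
    if F: "finite F" "F \<subseteq> X" for F
  proof -
    have "integral\<^sup>L M S - (\<Sum>m\<in>F. integral\<^sup>L M (g m)) = (\<integral>x. S x - (\<Sum>m\<in>F. g m x) \<partial>M)"
      using F g intS by (subst Bochner_Integration.integral_diff)
        (auto intro!: Bochner_Integration.integrable_sum simp: Bochner_Integration.integral_sum subset_iff)
    also have "norm \<dots> \<le> (\<integral>x. norm (S x - (\<Sum>m\<in>F. g m x)) \<partial>M)"
      by (rule integral_norm_bound)
    also have "\<dots> \<le> (\<integral>x. (T - sum N F) * w x \<partial>M)"
      using F g w diff
      by (intro Bochner_Integration.integral_mono integrable_norm Bochner_Integration.integrable_diff
            Bochner_Integration.integrable_sum intS integrable_mult_right) auto
    finally show ?thesis by simp
  qed
  hence "eventually (\<lambda>F. norm ((\<Sum>m\<in>F. integral\<^sup>L M (g m)) - integral\<^sup>L M S) \<le>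
      (T - sum N F) * integral\<^sup>L M w) (finite_subsets_at_top X)"
    by (intro eventually_finite_subsets_at_top_weakI) (simp add: norm_minus_commute)
  moreover have "((\<lambda>F. (T - sum N F) * integral\<^sup>L M w) \<longlongrightarrow> (T - T) * integral\<^sup>L M w) (finite_subsets_at_top X)"
    using T unfolding has_sum_def by (intro tendsto_intros)
  hence "((\<lambda>F. (T - sum N F) * integral\<^sup>L M w) \<longlongrightarrow> 0) (finite_subsets_at_top X)" by simp
  ultimately have "((\<lambda>F. (\<Sum>m\<in>F. integral\<^sup>L M (g m)) - integral\<^sup>L M S) \<longlongrightarrow> 0) (finite_subsets_at_top X)"
    by (rule Lim_null_comparison)
  thus ?thesis unfolding has_sum_def by (simp add: LIM_zero_iff)
qed

text \<open>Turns the product of the Fourier series, one for each simple root, into a single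
  absolutely convergent sum over integer vectors.\<close>

lemma has_sum_prod_PiE:
  fixes f :: "'a \<Rightarrow> 'b :: countable \<Rightarrow> complex"
  assumes "finite A" and "\<And>x. x \<in> A \<Longrightarrow> (\<lambda>y. norm (f x y)) summable_on B x"
    and "\<And>x. x \<in> A \<Longrightarrow> (f x has_sum s x) (B x)"
  shows "(\<lambda>g. norm (\<Prod>x\<in>A. f x (g x))) summable_on PiE A B"
    and "((\<lambda>g. \<Prod>x\<in>A. f x (g x)) has_sum (\<Prod>x\<in>A. s x)) (PiE A B)"
proof -
  show *: "(\<lambda>g. norm (\<Prod>x\<in>A. f x (g x))) summable_on PiE A B"
    unfolding abs_summable_equivalent using assms(1,2)
    by (intro abs_summable_on_prod_PiE) (auto simp flip: abs_summable_equivalent)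
  have "infsum (\<lambda>g. \<Prod>x\<in>A. f x (g x)) (PiE A B) = (\<Prod>x\<in>A. infsum (f x) (B x))"
    using assms(1,2) by (rule infsum_prod_PiE_abs)
  also have "\<dots> = (\<Prod>x\<in>A. s x)"
    using assms(3) by (intro prod.cong) (auto simp: infsumI)
  finally show "((\<lambda>g. \<Prod>x\<in>A. f x (g x)) has_sum (\<Prod>x\<in>A. s x)) (PiE A B)"
    using has_sum_infsum[OF abs_summable_summable[OF *]] by simp
qed

lemma indicator_PiE_prod:
  assumes "finite I" "x \<in> extensional I"
  shows "indicator (PiE I A) x = (\<Prod>i\<in>I. indicator (A i) (x i) :: 'b :: {comm_semiring_1})"
proof (cases "x \<in> PiE I A")
  case True
  thus ?thesis using assms by (auto intro!: prod.neutral[symmetric] simp: PiE_iff)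
next
  case False
  then obtain i where "i \<in> I" "x i \<notin> A i" using assms by (auto simp: PiE_iff)
  hence "(\<Prod>i\<in>I. indicator (A i) (x i) :: 'b) = 0"
    using assms by (intro prod_zero) (auto intro!: bexI[of _ i])
  thus ?thesis using False by simp
qed

text \<open>Fubini for separated variables: the indicator of the cube factors as well. The value
  type is generic because the majorant is real and the Fourier integrand complex.\<close>

lemma unit_cube_integral_prod:
  fixes F :: "'a \<Rightarrow> real \<Rightarrow> 'b :: {real_normed_field, banach, second_countable_topology, euclidean_space}"
  assumes I: "finite I" and F: "\<And>i. i \<in> I \<Longrightarrow> continuous_on {0..1} (F i)"
  shows "set_integrable (\<Pi>\<^sub>M i\<in>I. lborel) (\<Pi>\<^sub>E i\<in>I. {0..1}) (\<lambda>x. \<Prod>i\<in>I. F i (x i))"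
    and "(LINT x : (\<Pi>\<^sub>E i\<in>I. {0..1}) | (\<Pi>\<^sub>M i\<in>I. lborel). \<Prod>i\<in>I. F i (x i)) =
         (\<Prod>i\<in>I. integral {0..1} (F i))"
proof -
  interpret product_sigma_finite "\<lambda>_::'a. lborel :: real measure" ..
  have F': "set_integrable lborel {0..1} (F i)" if "i \<in> I" for i
    using F[OF that] by (rule borel_integrable_atLeastAtMost')
  have eq: "indicator (\<Pi>\<^sub>E i\<in>I. {0..1}) x *\<^sub>R (\<Prod>i\<in>I. F i (x i)) =
      (\<Prod>i\<in>I. indicator {0..1} (x i) *\<^sub>R F i (x i))"
    if "x \<in> space (\<Pi>\<^sub>M i\<in>I. lborel :: real measure)" for x
    using that I by (subst indicator_PiE_prod)
      (auto simp: space_PiM PiE_def scaleR_conv_of_real prod.distrib)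
  show "set_integrable (\<Pi>\<^sub>M i\<in>I. lborel) (\<Pi>\<^sub>E i\<in>I. {0..1}) (\<lambda>x. \<Prod>i\<in>I. F i (x i))"
    unfolding set_integrable_def using F'
    by (subst Bochner_Integration.integrable_cong[OF refl eq])
       (auto intro!: product_integrable_prod I simp: set_integrable_def)
  have "(LINT x : (\<Pi>\<^sub>E i\<in>I. {0..1}) | (\<Pi>\<^sub>M i\<in>I. lborel). \<Prod>i\<in>I. F i (x i)) =
      (\<integral>x. (\<Prod>i\<in>I. indicator {0..1} (x i) *\<^sub>R F i (x i)) \<partial>(\<Pi>\<^sub>M i\<in>I. lborel))"
    unfolding set_lebesgue_integral_def by (intro Bochner_Integration.integral_cong refl eq)
  also have "\<dots> = (\<Prod>i\<in>I. LINT x : {0..1} | lborel. F i x)"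
    unfolding set_lebesgue_integral_def using F'
    by (intro product_integral_prod I) (auto simp: set_integrable_def)
  also have "\<dots> = (\<Prod>i\<in>I. integral {0..1} (F i))"
    using F' by (intro prod.cong refl set_borel_integral_eq_integral(2)) auto
  finally show "(LINT x : (\<Pi>\<^sub>E i\<in>I. {0..1}) | (\<Pi>\<^sub>M i\<in>I. lborel). \<Prod>i\<in>I. F i (x i)) =
         (\<Prod>i\<in>I. integral {0..1} (F i))" .
qed

lemma borel_measurable_frac [measurable]: "frac \<in> borel_measurable (borel :: real measure)"
  unfolding frac_def by measurable

text \<open>The ratio between the m-th Fourier coefficient of B_k and \<open>1 / m ^ k\<close>. It
  does not depend on m and therefore leaves every sum.\<close>

definition bernoulli_scale :: "nat \<Rightarrow> complex" where
  "bernoulli_scale k = - fact k / (2 * of_real pi * \<i>) ^ k"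

text \<open>In the application \<open>m\<close> holds the coordinates of a weight \<nu>,
  \<open>t \<beta>\<close> is <y, \<lambda>_\<beta>> and \<open>a \<alpha> \<beta>\<close> is
  <\<alpha>^vee, \<lambda>_\<beta>>. Multiplying the series of the factors over
  \<open>\<Psi>\<close> gives a sum over \<open>m\<close> whose terms separate in the variables;
  each one-variable integral is then a Fourier coefficient at an integer frequency, which is where
  integrality of \<open>a\<close> enters.\<close>

lemma has_sum_unit_cube_bernoulli:
  fixes I \<Psi> :: "'a set" and t :: "'a \<Rightarrow> real" and a :: "'a \<Rightarrow> 'a \<Rightarrow> int"
  assumes I: "finite I" and \<Psi>: "finite \<Psi>" and kI: "\<And>\<alpha>. \<alpha> \<in> I \<Longrightarrow> k \<alpha> \<ge> 2"
    and k\<Psi>: "\<And>\<beta>. \<beta> \<in> \<Psi> \<Longrightarrow> k \<beta> \<ge> 2"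
  shows "((\<lambda>m. (\<Prod>\<alpha>\<in>I. bernoulli_scale (k \<alpha>)) * (\<Prod>\<beta>\<in>\<Psi>. bernoulli_scale (k \<beta>)) *
             (e2pi (\<Sum>\<beta>\<in>\<Psi>. of_int (m \<beta>) * t \<beta>) * (\<Prod>\<beta>\<in>\<Psi>. 1 / of_int (m \<beta>) ^ k \<beta>) *
             (\<Prod>\<alpha>\<in>I. 1 / of_int (\<Sum>\<beta>\<in>\<Psi>. m \<beta> * a \<alpha> \<beta>) ^ k \<alpha>))) has_sum
         of_real (LINT x : (\<Pi>\<^sub>E \<alpha>\<in>I. {0..1}) | (\<Pi>\<^sub>M \<alpha>\<in>I. lborel).
           (\<Prod>\<alpha>\<in>I. bernoulli_poly (k \<alpha>) (x \<alpha>)) *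
           (\<Prod>\<beta>\<in>\<Psi>. bernoulli_poly (k \<beta>) (frac (t \<beta> - (\<Sum>\<alpha>\<in>I. x \<alpha> * of_int (a \<alpha> \<beta>)))))))
         (\<Pi>\<^sub>E \<beta>\<in>\<Psi>. UNIV)"
    (is "(?rhs has_sum of_real (LINT x : ?A | ?M. ?P x * ?Q x)) ?X")
proof -
  define c where "c \<beta> n = bernoulli_scale (k \<beta>) * (1 / of_int n ^ k \<beta>)" for \<beta> and n :: int
  define u where "u \<beta> x = t \<beta> - (\<Sum>\<alpha>\<in>I. x \<alpha> * of_int (a \<alpha> \<beta>))" for \<beta> x
  define L where "L m \<alpha> = (\<Sum>\<beta>\<in>\<Psi>. m \<beta> * a \<alpha> \<beta>)" for m \<alpha>
  define G where "G m x = complex_of_real (?P x) * (\<Prod>\<beta>\<in>\<Psi>. c \<beta> (m \<beta>) * e2pi (of_int (m \<beta>) * u \<beta> x))" for m x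
  define K where "K m = (\<Prod>\<beta>\<in>\<Psi>. c \<beta> (m \<beta>)) * e2pi (\<Sum>\<beta>\<in>\<Psi>. of_int (m \<beta>) * t \<beta>)" for m
  have c_sum: "(\<lambda>n. norm (c \<beta> n)) summable_on UNIV" if "\<beta> \<in> \<Psi>" for \<beta>
    using summable_on_cmult_right[OF summable_on_int_inverse_power[OF k\<Psi>[OF that]], of "norm (bernoulli_scale (k \<beta>))"]
    by (simp only: c_def norm_mult)
  \<comment> \<open>The phases are collected by variable: after exchanging the two sums,
    \<open>x \<alpha>\<close> carries the frequency \<open>- L m \<alpha>\<close>, where
    \<open>L m \<alpha>\<close> plays the role of <\<alpha>^vee, \<nu>>.\<close>
  have G_eq: "G m x = K m * (\<Prod>\<alpha>\<in>I. of_real (bernoulli_poly (k \<alpha>) (x \<alpha>)) * e2pi (- of_int (L m \<alpha>) * x \<alpha>))" for m x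
  proof -
    have "(\<Sum>\<beta>\<in>\<Psi>. of_int (m \<beta>) * u \<beta> x) =
        (\<Sum>\<beta>\<in>\<Psi>. of_int (m \<beta>) * t \<beta>) - (\<Sum>\<beta>\<in>\<Psi>. \<Sum>\<alpha>\<in>I. of_int (m \<beta> * a \<alpha> \<beta>) * x \<alpha>)"
      by (simp add: u_def algebra_simps sum_subtractf sum_distrib_left)
    also have "(\<Sum>\<beta>\<in>\<Psi>. \<Sum>\<alpha>\<in>I. of_int (m \<beta> * a \<alpha> \<beta>) * x \<alpha>) = (\<Sum>\<alpha>\<in>I. of_int (L m \<alpha>) * x \<alpha>)"
      by (subst sum.swap) (simp add: L_def sum_distrib_right)
    finally have "e2pi (\<Sum>\<beta>\<in>\<Psi>. of_int (m \<beta>) * u \<beta> x) =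
        e2pi (\<Sum>\<beta>\<in>\<Psi>. of_int (m \<beta>) * t \<beta>) * e2pi (\<Sum>\<alpha>\<in>I. - of_int (L m \<alpha>) * x \<alpha>)"
      by (simp add: sum_negf flip: e2pi_add)
    thus ?thesis
      by (simp add: G_def K_def prod.distrib e2pi_sum[OF \<Psi>, symmetric] e2pi_sum[OF I, symmetric])
  qed
  have G_sum: "((\<lambda>m. G m x) has_sum of_real (?P x * ?Q x)) ?X" for x
    unfolding G_def of_real_mult of_real_prod
  proof (intro has_sum_cmult_right has_sum_prod_PiE(2) \<Psi>)
    fix \<beta> assume \<beta>: "\<beta> \<in> \<Psi>"
    show "(\<lambda>n. norm (c \<beta> n * e2pi (of_int n * u \<beta> x))) summable_on UNIV"
      using c_sum[OF \<beta>] by (simp add: norm_mult)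
    show "((\<lambda>n. c \<beta> n * e2pi (of_int n * u \<beta> x)) has_sum
        of_real (bernoulli_poly (k \<beta>) (frac (t \<beta> - (\<Sum>\<alpha>\<in>I. x \<alpha> * of_int (a \<alpha> \<beta>)))))) UNIV"
      using bernoulli_poly_frac_fourier[OF k\<Psi>[OF \<beta>], of "u \<beta> x"]
      by (simp add: c_def u_def bernoulli_scale_def)
  qed
  have "((\<lambda>m. \<integral>x. indicator ?A x *\<^sub>R G m x \<partial>?M) has_sum (\<integral>x. indicator ?A x *\<^sub>R of_real (?P x * ?Q x) \<partial>?M)) ?X"
  proof (rule has_sum_integral)
    show "integrable ?M (\<lambda>x. indicator ?A x *\<^sub>R G m x)" for m
    proof -
      have "set_integrable ?M ?A (\<lambda>x. \<Prod>\<alpha>\<in>I. complex_of_real (bernoulli_poly (k \<alpha>) (x \<alpha>)) *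
          e2pi (- of_int (L m \<alpha>) * x \<alpha>))"
        by (intro unit_cube_integral_prod I continuous_intros)
      thus ?thesis unfolding G_eq[abs_def]
        using set_integrable_mult_right[of "K m"] by (auto simp: set_integrable_def)
    qed
    have "set_integrable ?M ?A (\<lambda>x. \<Prod>\<alpha>\<in>I. \<bar>bernoulli_poly (k \<alpha>) (x \<alpha>)\<bar>)"
      by (intro unit_cube_integral_prod I continuous_intros)
    thus "integrable ?M (\<lambda>x. indicator ?A x *\<^sub>R (\<Prod>\<alpha>\<in>I. \<bar>bernoulli_poly (k \<alpha>) (x \<alpha>)\<bar>))"
      by (simp add: set_integrable_def)
    \<comment> \<open>All phases have modulus 1, so the majorant splits into a summable factor in
      \<open>m\<close> and an integrable factor in \<open>x\<close>.\<close>
    show "norm (indicator ?A x *\<^sub>R G m x) \<le>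
        norm (\<Prod>\<beta>\<in>\<Psi>. c \<beta> (m \<beta>)) * (indicator ?A x *\<^sub>R (\<Prod>\<alpha>\<in>I. \<bar>bernoulli_poly (k \<alpha>) (x \<alpha>)\<bar>))" for m x
      by (auto simp: G_def norm_mult abs_prod prod_norm[symmetric] indicator_def)
    show "(\<lambda>m. norm (\<Prod>\<beta>\<in>\<Psi>. c \<beta> (m \<beta>))) summable_on ?X"
      by (rule has_sum_prod_PiE(1)[OF \<Psi> c_sum has_sum_infsum[OF abs_summable_summable[OF c_sum]]])
    have [measurable]: "?A \<in> sets ?M"
      using I by (intro sets_PiM_I_finite) auto
    show "(\<lambda>x. indicator ?A x *\<^sub>R complex_of_real (?P x * ?Q x)) \<in> borel_measurable ?M"
      by measurable
    show "((\<lambda>m. indicator ?A x *\<^sub>R G m x) has_sum indicator ?A x *\<^sub>R of_real (?P x * ?Q x)) ?X" for x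
      using G_sum[of x] by (cases "x \<in> ?A") simp_all
  qed
  moreover have "(\<integral>x. indicator ?A x *\<^sub>R complex_of_real (?P x * ?Q x) \<partial>?M) = of_real (LINT x : ?A | ?M. ?P x * ?Q x)"
    by (subst set_integral_complex_of_real[symmetric]) (simp add: set_lebesgue_integral_def)
  moreover have "(\<integral>x. indicator ?A x *\<^sub>R G m x \<partial>?M) = ?rhs m" for m
  proof -
    have "(\<integral>x. indicator ?A x *\<^sub>R G m x \<partial>?M) = K m * (LINT x : ?A | ?M. (\<Prod>\<alpha>\<in>I. complex_of_real (bernoulli_poly (k \<alpha>) (x \<alpha>)) *
          e2pi (- of_int (L m \<alpha>) * x \<alpha>)))"
      unfolding G_eq by (subst set_integral_mult_right[symmetric]) (simp only: set_lebesgue_integral_def)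
    also have "(LINT x : ?A | ?M. (\<Prod>\<alpha>\<in>I. complex_of_real (bernoulli_poly (k \<alpha>) (x \<alpha>)) *
          e2pi (- of_int (L m \<alpha>) * x \<alpha>))) = (\<Prod>\<alpha>\<in>I. integral {0..1} (\<lambda>x. complex_of_real (bernoulli_poly (k \<alpha>) x) *
          e2pi (- of_int (L m \<alpha>) * x)))"
      by (intro unit_cube_integral_prod I continuous_intros)
    also have "\<dots> = (\<Prod>\<alpha>\<in>I. bernoulli_scale (k \<alpha>) * (1 / of_int (L m \<alpha>) ^ k \<alpha>))"
    proof (intro prod.cong refl)
      fix \<alpha> assume "\<alpha> \<in> I"
      from kI[OF this] show "integral {0..1} (\<lambda>x. complex_of_real (bernoulli_poly (k \<alpha>) x) *
          e2pi (- of_int (L m \<alpha>) * x)) = bernoulli_scale (k \<alpha>) * (1 / of_int (L m \<alpha>) ^ k \<alpha>)"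
        unfolding bernoulli_scale_def by (intro bernoulli_poly_fourier_coeff) auto
    qed
    finally show ?thesis
      by (simp only: K_def c_def L_def prod.distrib mult_ac)
  qed
  ultimately show ?thesis by simp
qed

section \<open>Dual bases\<close>

text \<open>One notion for roots with coweights and coroots with weights, in either order, so that
  all four lattices share one membership test. Spanning is asked of \<open>b\<close>; that of
  \<open>b'\<close> follows by expanding vectors.\<close>

definition dual_bases :: "'a::euclidean_space set \<Rightarrow> ('a \<Rightarrow> 'a) \<Rightarrow> ('a \<Rightarrow> 'a) \<Rightarrow> bool" where
  "dual_bases \<Psi> b b' \<longleftrightarrow> finite \<Psi> \<and> span (b ` \<Psi>) = UNIV \<and>
     (\<forall>\<alpha>\<in>\<Psi>. \<forall>\<beta>\<in>\<Psi>. b \<alpha> \<bullet> b' \<beta> = (if \<alpha> = \<beta> then 1 else 0))"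

lemma inner_spanning_eq_0:
  fixes v :: "'a::euclidean_space"
  assumes "span B = UNIV" "\<And>b. b \<in> B \<Longrightarrow> b \<bullet> v = 0"
  shows "v = 0"
proof -
  have "orthogonal v v"
    using assms by (intro orthogonal_to_span[of v B]) (auto simp: orthogonal_def inner_commute)
  thus ?thesis by (simp add: orthogonal_def)
qed

lemma dual_bases_expand:
  assumes "dual_bases \<Psi> b b'"
  shows "v = (\<Sum>\<beta>\<in>\<Psi>. (b \<beta> \<bullet> v) *\<^sub>R b' \<beta>)"
proof -
  have "v - (\<Sum>\<beta>\<in>\<Psi>. (b \<beta> \<bullet> v) *\<^sub>R b' \<beta>) = 0"
    using assms unfolding dual_bases_def
    by (intro inner_spanning_eq_0[of "b ` \<Psi>"])
       (auto simp: inner_diff_right inner_sum_right if_distrib[of "\<lambda>x. _ * x"] cong: if_cong)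
  thus ?thesis by simp
qed

lemma dual_bases_sym:
  assumes "dual_bases \<Psi> b b'"
  shows "dual_bases \<Psi> b' b"
proof -
  have "v \<in> span (b' ` \<Psi>)" for v
    by (subst dual_bases_expand[OF assms]) (intro span_sum span_scale span_base imageI)
  thus ?thesis using assms unfolding dual_bases_def by (auto simp: inner_commute)
qed

lemma dual_bases_inner_sum:
  assumes "dual_bases \<Psi> b b'" "\<beta> \<in> \<Psi>"
  shows "b' \<beta> \<bullet> (\<Sum>\<alpha>\<in>\<Psi>. c \<alpha> *\<^sub>R b \<alpha>) = c \<beta>"
  using assms unfolding dual_bases_def
  by (auto simp: inner_sum_right inner_commute[of "b' \<beta>"] if_distrib[of "\<lambda>x. _ * x"] cong: if_cong)

text \<open>Pairing with the dual family reads off the coordinates. Lattice membership thereby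
  becomes a list of integrality conditions.\<close>

lemma int_span_iff:
  assumes "dual_bases \<Psi> b b'"
  shows "v \<in> int_span \<Psi> b \<longleftrightarrow> (\<forall>\<beta>\<in>\<Psi>. b' \<beta> \<bullet> v \<in> \<int>)"
proof
  assume "v \<in> int_span \<Psi> b"
  thus "\<forall>\<beta>\<in>\<Psi>. b' \<beta> \<bullet> v \<in> \<int>"
    using dual_bases_inner_sum[OF assms] by (auto simp: int_span_def)
next
  assume *: "\<forall>\<beta>\<in>\<Psi>. b' \<beta> \<bullet> v \<in> \<int>"
  have "v = (\<Sum>\<beta>\<in>\<Psi>. (b' \<beta> \<bullet> v) *\<^sub>R b \<beta>)"
    by (rule dual_bases_expand[OF dual_bases_sym[OF assms]])
  also have "\<dots> = (\<Sum>\<beta>\<in>\<Psi>. of_int \<lfloor>b' \<beta> \<bullet> v\<rfloor> *\<^sub>R b \<beta>)"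
    using * by (intro sum.cong) (auto simp: Ints_def)
  finally show "v \<in> int_span \<Psi> b"
    unfolding int_span_def by (auto intro: exI[of _ "\<lambda>\<beta>. \<lfloor>b' \<beta> \<bullet> v\<rfloor>"])
qed

text \<open>A functional prescribed on the basis is represented by the vector
  \<open>adjoint f 1\<close>. Existence and uniqueness justify the definite descriptions behind
  fundamental weights and coweights.\<close>

lemma basis_functional_ex1:
  fixes \<Psi> :: "'a::euclidean_space set"
  assumes "independent \<Psi>" "span \<Psi> = UNIV"
  shows "\<exists>!v. \<forall>\<alpha>\<in>\<Psi>. v \<bullet> \<alpha> = g \<alpha>"
proof -
  obtain f where f: "linear f" "\<And>x. x \<in> \<Psi> \<Longrightarrow> f x = g x"
    using linear_independent_extend[OF assms(1)] by blast
  define v where "v = adjoint f 1"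
  have "v \<bullet> x = f x" for x
    using adjoint_works[OF f(1), of x 1] by (simp add: v_def inner_commute)
  hence "\<forall>\<alpha>\<in>\<Psi>. v \<bullet> \<alpha> = g \<alpha>" using f by simp
  moreover have "v' = v''" if "\<forall>\<alpha>\<in>\<Psi>. v' \<bullet> \<alpha> = g \<alpha>" "\<forall>\<alpha>\<in>\<Psi>. v'' \<bullet> \<alpha> = g \<alpha>" for v' v''
  proof -
    have "v' - v'' = 0"
      using that by (intro inner_spanning_eq_0[OF assms(2)]) (simp add: inner_diff_right inner_commute)
    thus ?thesis by simp
  qed
  ultimately show ?thesis by blast
qed

section \<open>Reflections\<close>

lemma inner_root_reflection:
  "v \<bullet> root_reflection \<alpha> u = v \<bullet> u - (coroot \<alpha> \<bullet> u) * (v \<bullet> \<alpha>)"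
  by (simp add: root_reflection_def inner_diff_right)

lemma coroot_inner_self: "\<alpha> \<noteq> 0 \<Longrightarrow> coroot \<alpha> \<bullet> \<alpha> = 2"
  by (simp add: coroot_def)

lemma root_reflection_self: "\<alpha> \<noteq> 0 \<Longrightarrow> root_reflection \<alpha> \<alpha> = - \<alpha>"
  by (simp add: root_reflection_def coroot_inner_self)
     (metis scaleR_2 diff_add_cancel add_diff_cancel_left' diff_minus_eq_add minus_diff_eq)

lemma linear_root_reflection: "linear (root_reflection \<alpha>)"
  by (rule linearI) (auto simp: root_reflection_def inner_add_right algebra_simps)

lemma root_reflection_involution: "root_reflection \<alpha> (root_reflection \<alpha> v) = v"
proof (cases "\<alpha> = 0")
  case False
  thus ?thesis
    by (simp add: root_reflection_def inner_diff_right coroot_inner_self algebra_simps flip: scaleR_add_left)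
qed (simp add: root_reflection_def)

lemma root_reflection_comp_self: "root_reflection \<alpha> \<circ> root_reflection \<alpha> = id"
  by (simp add: fun_eq_iff root_reflection_involution)

lemma orthogonal_transformation_root_reflection: "orthogonal_transformation (root_reflection \<alpha>)"
proof (cases "\<alpha> = 0")
  case True
  thus ?thesis by (simp add: orthogonal_transformation_def linear_root_reflection root_reflection_def)
next
  case False
  hence "(root_reflection \<alpha> v) \<bullet> (root_reflection \<alpha> w) = v \<bullet> w" for v w
    by (simp add: root_reflection_def coroot_def inner_diff_left inner_diff_right inner_commute field_simps)
  thus ?thesis by (simp add: orthogonal_transformation_def linear_root_reflection)
qed

lemma root_reflection_minus: "root_reflection (- \<alpha>) = root_reflection \<alpha>"
  by (simp add: fun_eq_iff root_reflection_def coroot_def)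

lemma coroot_minus: "coroot (- \<alpha>) = - coroot \<alpha>"
  by (simp add: coroot_def)

lemma coroot_orthogonal:
  assumes "orthogonal_transformation w"
  shows "coroot (w \<alpha>) = w (coroot \<alpha>)"
  using assms by (simp add: coroot_def orthogonal_transformation_def linear_cmul)

lemma root_reflection_conj:
  assumes "orthogonal_transformation w"
  shows "w (root_reflection \<alpha> v) = root_reflection (w \<alpha>) (w v)"
  using assms by (simp add: root_reflection_def coroot_orthogonal)
    (simp add: orthogonal_transformation_def linear_diff linear_cmul)

text \<open>Isometries commute with forming coroots, and <\<beta>^vee, \<alpha>^vee> \<beta> =
  <\<alpha>^vee, \<beta>> \<beta>^vee. In this form the change is an integral multiple of a
  coroot.\<close>

lemma coroot_root_reflection:
  "coroot (root_reflection \<beta> \<alpha>) = coroot \<alpha> - (coroot \<alpha> \<bullet> \<beta>) *\<^sub>R coroot \<beta>"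
proof -
  have "coroot (root_reflection \<beta> \<alpha>) = root_reflection \<beta> (coroot \<alpha>)"
    by (rule coroot_orthogonal[OF orthogonal_transformation_root_reflection])
  thus ?thesis by (simp add: root_reflection_def coroot_def inner_commute)
qed

text \<open>Group elements are handled as words so that induction on the length and deletion of
  letters are available. The first letter acts last.\<close>

definition reflection_word :: "'a::euclidean_space list \<Rightarrow> 'a \<Rightarrow> 'a" where
  "reflection_word ls = foldr (\<lambda>\<beta> g. root_reflection \<beta> \<circ> g) ls id"

lemma reflection_word_simps [simp]:
  "reflection_word [] = id"
  "reflection_word (\<beta> # ls) = root_reflection \<beta> \<circ> reflection_word ls"
  by (simp_all add: reflection_word_def)

lemma reflection_word_append: "reflection_word (xs @ ys) = reflection_word xs \<circ> reflection_word ys"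
  by (induction xs) (auto simp: o_assoc)

lemma reflection_word_rev: "reflection_word (rev xs) \<circ> reflection_word xs = id"
  by (induction xs) (simp_all add: reflection_word_append fun_eq_iff root_reflection_involution)

lemma reflection_word_rev': "reflection_word xs \<circ> reflection_word (rev xs) = id"
  using reflection_word_rev[of "rev xs"] by simp

lemma orthogonal_reflection_word: "orthogonal_transformation (reflection_word ls)"
proof (induction ls)
  case (Cons \<beta> ls)
  thus ?case unfolding reflection_word_simps
    by (intro orthogonal_transformation_compose orthogonal_transformation_root_reflection)
qed (simp add: id_def)

lemma bij_reflection_word: "bij (reflection_word ls)"
  using reflection_word_rev reflection_word_rev' by (rule o_bij)

section \<open>Root systems\<close>

lemma sum_in_Nats: "(\<And>x. x \<in> A \<Longrightarrow> f x \<in> \<nat>) \<Longrightarrow> sum f A \<in> \<nat>"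
  by (induction A rule: infinite_finite_induct) auto

locale root_basis =
  fixes \<Delta> \<Psi> :: "'a::euclidean_space set"
  assumes root_system: "reduced_root_system \<Delta>" and simple_system: "fundamental_system \<Delta> \<Psi>"
begin

abbreviation "\<Delta>p \<equiv> positive_roots \<Delta> \<Psi>"
abbreviation "\<Delta>n \<equiv> negative_roots \<Delta> \<Psi>"
abbreviation "W \<equiv> weyl_group \<Delta>"
abbreviation "weight \<equiv> fundamental_weight \<Psi>"
abbreviation "coweight \<equiv> fundamental_coweight \<Psi>"

lemma finite_roots: "finite \<Delta>" and root_neq_0: "\<alpha> \<in> \<Delta> \<Longrightarrow> \<alpha> \<noteq> 0" and span_roots: "span \<Delta> = UNIV"
  and reflection_roots: "\<alpha> \<in> \<Delta> \<Longrightarrow> root_reflection \<alpha> ` \<Delta> = \<Delta>"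
  and coroot_root_Ints: "\<alpha> \<in> \<Delta> \<Longrightarrow> \<beta> \<in> \<Delta> \<Longrightarrow> coroot \<alpha> \<bullet> \<beta> \<in> \<int>"
  and root_multiple: "\<alpha> \<in> \<Delta> \<Longrightarrow> c *\<^sub>R \<alpha> \<in> \<Delta> \<Longrightarrow> c = 1 \<or> c = -1"
  using root_system unfolding reduced_root_system_def by blast+

lemma simple_subset: "\<Psi> \<subseteq> \<Delta>" and independent_simple: "independent \<Psi>" and span_simple: "span \<Psi> = UNIV"
  and roots_split: "\<Delta> = \<Delta>p \<union> \<Delta>n"
  using simple_system unfolding fundamental_system_def by blast+

lemma finite_simple: "finite \<Psi>"
  using simple_subset finite_roots by (rule finite_subset)

lemma simple_root: "\<beta> \<in> \<Psi> \<Longrightarrow> \<beta> \<in> \<Delta>" and positive_root: "\<alpha> \<in> \<Delta>p \<Longrightarrow> \<alpha> \<in> \<Delta>"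
  using simple_subset by (auto simp: positive_roots_def)

lemma finite_positive: "finite \<Delta>p"
  by (rule finite_subset[OF _ finite_roots]) (auto dest: positive_root)

lemma dual_root_coweight: "dual_bases \<Psi> (\<lambda>\<alpha>. \<alpha>) coweight"
proof -
  have "\<alpha> \<bullet> coweight \<beta> = (if \<alpha> = \<beta> then 1 else 0)" if "\<alpha> \<in> \<Psi>" for \<alpha> \<beta>
    using theI'[OF basis_functional_ex1[OF independent_simple span_simple, of "\<lambda>\<alpha>. if \<alpha> = \<beta> then 1 else 0"]] that
    unfolding fundamental_coweight_def by (subst inner_commute) auto
  thus ?thesis unfolding dual_bases_def using finite_simple span_simple by simp
qed

lemma dual_coroot_weight: "dual_bases \<Psi> coroot weight"
proof -
  have "coroot \<alpha> \<bullet> weight \<beta> = (if \<alpha> = \<beta> then 1 else 0)" if "\<alpha> \<in> \<Psi>" for \<alpha> \<beta>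
  proof -
    \<comment> \<open>The coroot condition is a root condition rescaled by half the squared length,
      so existence and uniqueness carry over from functionals prescribed on
      \<open>\<Psi>\<close>.\<close>
    have iff: "coroot \<alpha> \<bullet> v = (if \<alpha> = \<beta> then 1 else 0) \<longleftrightarrow> v \<bullet> \<alpha> = (if \<alpha> = \<beta> then (\<alpha> \<bullet> \<alpha>) / 2 else 0)"
      if "\<alpha> \<in> \<Psi>" for \<alpha> v
      using root_neq_0[OF simple_root[OF that]] by (auto simp: coroot_def inner_commute field_simps)
    have "\<exists>!v. \<forall>\<alpha>\<in>\<Psi>. coroot \<alpha> \<bullet> v = (if \<alpha> = \<beta> then 1 else 0)"
      using basis_functional_ex1[OF independent_simple span_simple, of "\<lambda>\<alpha>. if \<alpha> = \<beta> then (\<alpha> \<bullet> \<alpha>) / 2 else 0"]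
      by (simp only: iff cong: ball_cong)
    from theI'[OF this] show ?thesis unfolding fundamental_weight_def using that by blast
  qed
  moreover have "span (coroot ` \<Psi>) = UNIV"
  proof -
    have "\<Psi> \<subseteq> span (coroot ` \<Psi>)"
    proof
      fix \<alpha> assume \<alpha>: "\<alpha> \<in> \<Psi>"
      have "\<alpha> = ((\<alpha> \<bullet> \<alpha>) / 2) *\<^sub>R coroot \<alpha>"
        using root_neq_0[OF simple_root[OF \<alpha>]] by (simp add: coroot_def)
      thus "\<alpha> \<in> span (coroot ` \<Psi>)" using \<alpha> by (metis span_base span_scale imageI)
    qed
    thus ?thesis using span_simple by (metis span_mono span_span top.extremum_uniqueI)
  qed
  ultimately show ?thesis unfolding dual_bases_def using finite_simple by simp
qed

lemma coweight_simple: "\<alpha> \<in> \<Psi> \<Longrightarrow> \<beta> \<in> \<Psi> \<Longrightarrow> coweight \<beta> \<bullet> \<alpha> = (if \<alpha> = \<beta> then 1 else 0)"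
  using dual_root_coweight unfolding dual_bases_def by (simp add: inner_commute)

lemma simple_expand: "v = (\<Sum>\<beta>\<in>\<Psi>. (coweight \<beta> \<bullet> v) *\<^sub>R \<beta>)"
  by (rule dual_bases_expand[OF dual_bases_sym[OF dual_root_coweight]])

lemma weight_expand: "v = (\<Sum>\<beta>\<in>\<Psi>. (coroot \<beta> \<bullet> v) *\<^sub>R weight \<beta>)"
  by (rule dual_bases_expand[OF dual_coroot_weight])

section \<open>Positive roots, simple reflections and height\<close>

lemma positive_coweight_Nats: "\<alpha> \<in> \<Delta>p \<Longrightarrow> \<beta> \<in> \<Psi> \<Longrightarrow> coweight \<beta> \<bullet> \<alpha> \<in> \<nat>"
  using dual_bases_inner_sum[OF dual_root_coweight, of \<beta>] by (auto simp: positive_roots_def)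

lemma positive_coweight_ge_0: "\<alpha> \<in> \<Delta>p \<Longrightarrow> \<beta> \<in> \<Psi> \<Longrightarrow> coweight \<beta> \<bullet> \<alpha> \<ge> 0"
  using positive_coweight_Nats[of \<alpha> \<beta>] by (auto simp: Nats_def)

lemma negative_iff: "\<alpha> \<in> \<Delta>n \<longleftrightarrow> - \<alpha> \<in> \<Delta>p"
  by (auto simp: negative_roots_def image_iff) (metis minus_minus)

lemma positive_not_negative:
  assumes "\<alpha> \<in> \<Delta>p" shows "\<alpha> \<notin> \<Delta>n"
proof
  assume "\<alpha> \<in> \<Delta>n"
  hence "coweight \<beta> \<bullet> \<alpha> = 0" if "\<beta> \<in> \<Psi>" for \<beta>
    using positive_coweight_ge_0[OF assms that] positive_coweight_ge_0[of "- \<alpha>" \<beta>] that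
    by (simp add: negative_iff)
  hence "\<alpha> = 0" by (subst simple_expand) simp
  thus False using root_neq_0[OF positive_root[OF assms]] by simp
qed

lemma simple_positive: "\<beta> \<in> \<Psi> \<Longrightarrow> \<beta> \<in> \<Delta>p"
proof (rule ccontr)
  assume \<beta>: "\<beta> \<in> \<Psi>" "\<beta> \<notin> \<Delta>p"
  hence "- \<beta> \<in> \<Delta>p" using roots_split simple_root negative_iff by blast
  from positive_coweight_ge_0[OF this \<beta>(1)] coweight_simple[OF \<beta>(1) \<beta>(1)] show False by simp
qed

text \<open>Reflection in \<open>\<beta>\<close> alters only the coordinate at
  \<open>\<beta>\<close>. A negative image would force all other coordinates of
  \<open>\<gamma>\<close> to vanish, and in a reduced system the only positive multiple of
  \<open>\<beta>\<close> is \<open>\<beta>\<close> itself.\<close>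

lemma simple_reflection_positive:
  assumes \<gamma>: "\<gamma> \<in> \<Delta>p" and \<beta>: "\<beta> \<in> \<Psi>" and neq: "\<gamma> \<noteq> \<beta>"
  shows "root_reflection \<beta> \<gamma> \<in> \<Delta>p"
proof (rule ccontr)
  assume not: "root_reflection \<beta> \<gamma> \<notin> \<Delta>p"
  have "root_reflection \<beta> \<gamma> \<in> \<Delta>"
    using reflection_roots[OF simple_root[OF \<beta>]] positive_root[OF \<gamma>] by blast
  hence neg: "- root_reflection \<beta> \<gamma> \<in> \<Delta>p" using not roots_split negative_iff by blast
  have "coweight \<beta>' \<bullet> \<gamma> = 0" if "\<beta>' \<in> \<Psi>" "\<beta>' \<noteq> \<beta>" for \<beta>'
    using positive_coweight_ge_0[OF neg that(1)] positive_coweight_ge_0[OF \<gamma> that(1)]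
      coweight_simple[OF \<beta> that(1)] that
    by (simp add: inner_root_reflection)
  hence "(\<Sum>\<beta>'\<in>\<Psi>. (coweight \<beta>' \<bullet> \<gamma>) *\<^sub>R \<beta>') = (\<Sum>\<beta>'\<in>\<Psi>. if \<beta>' = \<beta> then (coweight \<beta> \<bullet> \<gamma>) *\<^sub>R \<beta> else 0)"
    by (intro sum.cong) auto
  hence eq: "\<gamma> = (coweight \<beta> \<bullet> \<gamma>) *\<^sub>R \<beta>"
    using \<beta> finite_simple by (subst simple_expand) simp
  hence "coweight \<beta> \<bullet> \<gamma> = 1 \<or> coweight \<beta> \<bullet> \<gamma> = -1"
    using root_multiple[OF simple_root[OF \<beta>], of "coweight \<beta> \<bullet> \<gamma>"] positive_root[OF \<gamma>] by simp
  hence "coweight \<beta> \<bullet> \<gamma> = 1" using positive_coweight_ge_0[OF \<gamma> \<beta>] by auto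
  thus False using eq neq by simp
qed

text \<open>Induction on the height, the sum of the simple coordinates. For a nonsimple root some
  simple \<open>\<beta>\<close> has \<open>\<beta> \<bullet> \<alpha> > 0\<close>, since otherwise
  expanding \<open>\<alpha> \<bullet> \<alpha>\<close> would give a nonpositive number; reflecting
  in it preserves positivity and lowers the height.\<close>

lemma positive_root_induct [consumes 1, case_names simple reflect]:
  assumes "\<alpha> \<in> \<Delta>p"
    and simple: "\<And>\<beta>. \<beta> \<in> \<Psi> \<Longrightarrow> Q \<beta>"
    and reflect: "\<And>\<beta> \<gamma>. \<beta> \<in> \<Psi> \<Longrightarrow> \<gamma> \<in> \<Delta>p \<Longrightarrow> root_reflection \<beta> \<gamma> \<in> \<Delta>p \<Longrightarrow> Q (root_reflection \<beta> \<gamma>) \<Longrightarrow> Q \<gamma>"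
  shows "Q \<alpha>"
proof -
  define h where "h v = (\<Sum>\<beta>\<in>\<Psi>. coweight \<beta> \<bullet> v)" for v
  have "h v \<in> \<nat>" if "v \<in> \<Delta>p" for v
    unfolding h_def using positive_coweight_Nats[OF that] by (intro sum_in_Nats)
  then obtain n where "h \<alpha> = real n" using assms(1) by (auto simp: Nats_def)
  thus ?thesis using assms(1)
  proof (induction n arbitrary: \<alpha> rule: less_induct)
    case (less n)
    show ?case
    proof (cases "\<alpha> \<in> \<Psi>")
      case False
      have "\<exists>\<beta>\<in>\<Psi>. \<beta> \<bullet> \<alpha> > 0"
      proof (rule ccontr)
        assume "\<not> ?thesis"
        hence "(\<Sum>\<beta>\<in>\<Psi>. (coweight \<beta> \<bullet> \<alpha>) * (\<beta> \<bullet> \<alpha>)) \<le> 0"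
          using positive_coweight_ge_0[OF less.prems(2)]
          by (intro sum_nonpos mult_nonneg_nonpos) (auto simp: not_less)
        moreover have "\<alpha> \<bullet> \<alpha> = (\<Sum>\<beta>\<in>\<Psi>. (coweight \<beta> \<bullet> \<alpha>) * (\<beta> \<bullet> \<alpha>))"
          by (subst (1) simple_expand) (simp add: inner_sum_left)
        moreover have "\<alpha> \<bullet> \<alpha> > 0" using root_neq_0[OF positive_root[OF less.prems(2)]] by simp
        ultimately show False by linarith
      qed
      then obtain \<beta> where \<beta>: "\<beta> \<in> \<Psi>" "\<beta> \<bullet> \<alpha> > 0" by blast
      have pos: "root_reflection \<beta> \<alpha> \<in> \<Delta>p"
        using less.prems(2) \<beta>(1) False by (intro simple_reflection_positive) auto
      have "h \<beta> = 1"
        unfolding h_def using \<beta>(1) finite_simple by (simp add: coweight_simple)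
      hence "h (root_reflection \<beta> \<alpha>) = h \<alpha> - coroot \<beta> \<bullet> \<alpha>"
        unfolding h_def by (simp add: inner_root_reflection sum_subtractf flip: sum_distrib_left)
      moreover have "coroot \<beta> \<bullet> \<alpha> > 0"
        using \<beta> root_neq_0[OF simple_root[OF \<beta>(1)]] by (simp add: coroot_def)
      ultimately have "h (root_reflection \<beta> \<alpha>) < real n" using less.prems(1) by simp
      moreover obtain m where m: "h (root_reflection \<beta> \<alpha>) = real m"
        using \<open>\<And>v. v \<in> \<Delta>p \<Longrightarrow> h v \<in> \<nat>\<close>[OF pos] by (auto simp: Nats_def)
      ultimately have "Q (root_reflection \<beta> \<alpha>)" using pos by (intro less.IH) auto
      thus ?thesis using reflect \<beta>(1) less.prems(2) pos by blast
    qed (use simple in auto)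
  qed
qed

text \<open>Starting from a simple coroot, each reflection adds an integral multiple of a simple
  coroot, so all coroots lie in the coroot lattice. This makes the frequencies in the cube integral
  integers.\<close>

lemma coroot_weight_Ints:
  assumes "\<alpha> \<in> \<Delta>" "\<beta> \<in> \<Psi>"
  shows "coroot \<alpha> \<bullet> weight \<beta> \<in> \<int>"
proof -
  have "coroot \<alpha> \<bullet> weight \<beta> \<in> \<int>" if "\<alpha> \<in> \<Delta>p" for \<alpha>
    using that
  proof (induction rule: positive_root_induct)
    case (simple \<gamma>)
    thus ?case using dual_coroot_weight assms(2) unfolding dual_bases_def by simp
  next
    case (reflect \<gamma> \<alpha>)
    have "coroot \<gamma> \<bullet> weight \<beta> \<in> \<int>" 
      using dual_coroot_weight assms(2) reflect.hyps(1) unfolding dual_bases_def by simp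
    hence "coroot (root_reflection \<gamma> \<alpha>) \<bullet> weight \<beta> + (coroot \<alpha> \<bullet> \<gamma>) * (coroot \<gamma> \<bullet> weight \<beta>) \<in> \<int>"
      using reflect.IH coroot_root_Ints[OF positive_root[OF reflect.hyps(2)] simple_root[OF reflect.hyps(1)]]
      by (intro Ints_add Ints_mult)
    thus ?case by (simp add: coroot_root_reflection inner_diff_left)
  qed
  from this[of \<alpha>] this[of "- \<alpha>"] show ?thesis
    using assms(1) roots_split negative_iff by (auto simp: coroot_minus)
qed

section \<open>The Weyl group as words in simple reflections\<close>

lemma simple_reflection_negative_imp_eq:
  assumes "\<gamma> \<in> \<Delta>p" "\<beta> \<in> \<Psi>" "root_reflection \<beta> \<gamma> \<in> \<Delta>n"
  shows "\<gamma> = \<beta>"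
  using simple_reflection_positive[OF assms(1,2)] positive_not_negative assms(3) by blast

lemma reflection_word_root:
  assumes "set ls \<subseteq> \<Psi>" "\<alpha> \<in> \<Delta>"
  shows "reflection_word ls \<alpha> \<in> \<Delta>"
  using assms
proof (induction ls)
  case (Cons \<beta> ls)
  thus ?case using reflection_roots[OF simple_root[of \<beta>]] by auto
qed simp

text \<open>The letter at which the image of \<open>\<beta>\<close> turns negative cancels against \<open>\<beta>\<close>.\<close>

lemma reflection_word_exchange:
  assumes "set ls \<subseteq> \<Psi>" "\<beta> \<in> \<Psi>" "reflection_word ls \<beta> \<in> \<Delta>n"
  shows "\<exists>ls'. set ls' \<subseteq> \<Psi> \<and> Suc (length ls') = length ls \<and>
           reflection_word ls \<circ> root_reflection \<beta> = reflection_word ls'"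
  using assms
proof (induction ls)
  case Nil
  thus ?case using positive_not_negative[OF simple_positive[of \<beta>]] by simp
next
  case (Cons \<gamma> ls)
  show ?case
  proof (cases "reflection_word ls \<beta> \<in> \<Delta>n")
    case True
    then obtain ls' where ls': "set ls' \<subseteq> \<Psi>" "Suc (length ls') = length ls"
      "reflection_word ls \<circ> root_reflection \<beta> = reflection_word ls'"
      using Cons.IH[OF _ Cons.prems(2) True] Cons.prems(1) unfolding list.set by blast
    hence "reflection_word (\<gamma> # ls) \<circ> root_reflection \<beta> = reflection_word (\<gamma> # ls')"
      by (simp add: o_assoc[symmetric])
    moreover have "set (\<gamma> # ls') \<subseteq> \<Psi>" "Suc (length (\<gamma> # ls')) = length (\<gamma> # ls)"
      using ls'(1,2) Cons.prems(1) by auto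
    ultimately show ?thesis by blast
  next
    case False
    hence "reflection_word ls \<beta> \<in> \<Delta>p"
      using reflection_word_root[of ls \<beta>] Cons.prems(1,2) simple_root roots_split by auto
    hence "reflection_word ls \<beta> = \<gamma>"
      using Cons.prems by (intro simple_reflection_negative_imp_eq) auto
    \<comment> \<open>Conjugation by \<open>reflection_word ls\<close> carries the reflection in
      \<open>\<beta>\<close> to the one in \<open>\<gamma>\<close>, so the leading letter
      cancels.\<close>
    hence "reflection_word (\<gamma> # ls) \<circ> root_reflection \<beta> = reflection_word ls"
      using root_reflection_conj[OF orthogonal_reflection_word[of ls], of \<beta>]
      by (simp add: fun_eq_iff root_reflection_involution)
    moreover have "set ls \<subseteq> \<Psi>" "Suc (length ls) = length (\<gamma> # ls)"
      using Cons.prems(1) by auto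
    ultimately show ?thesis by blast
  qed
qed

text \<open>If the last letter \<open>\<beta>\<close> is sent to a positive root by the whole word,
  it is sent to a negative one by the word without that letter; the exchange step then yields the
  same map with two letters fewer.\<close>

lemma reflection_word_preserving_positive:
  assumes "set ls \<subseteq> \<Psi>" "\<And>\<beta>. \<beta> \<in> \<Psi> \<Longrightarrow> reflection_word ls \<beta> \<in> \<Delta>p"
  shows "reflection_word ls = id"
  using assms
proof (induction "length ls" arbitrary: ls rule: less_induct)
  case less
  show ?case
  proof (cases ls rule: rev_cases)
    case (snoc ms \<beta>)
    have \<beta>: "\<beta> \<in> \<Psi>" "set ms \<subseteq> \<Psi>" using less.prems(1) snoc by auto
    have eq: "reflection_word ls = reflection_word ms \<circ> root_reflection \<beta>"
      by (simp add: snoc reflection_word_append)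
    have "reflection_word ls \<beta> = - reflection_word ms \<beta>"
      using orthogonal_reflection_word[of ms] root_neq_0[OF simple_root[OF \<beta>(1)]]
      by (simp add: eq root_reflection_self orthogonal_transformation_def linear_neg)
    hence "reflection_word ms \<beta> \<in> \<Delta>n"
      using less.prems(2)[OF \<beta>(1)] by (simp add: negative_iff)
    from reflection_word_exchange[OF \<beta>(2,1) this] obtain ls' where ls':
      "set ls' \<subseteq> \<Psi>" "Suc (length ls') = length ms" "reflection_word ls = reflection_word ls'"
      unfolding eq by blast
    have "reflection_word ls' = id"
      using ls' less.prems by (intro less.hyps) (auto simp: snoc)
    thus ?thesis using ls' by simp
  qed simp
qed

text \<open>By induction along simple reflections: the reflection in \<open>\<gamma>\<close> is the
  conjugate, under the reflection in \<open>\<beta>\<close>, of the one in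
  \<open>root_reflection \<beta> \<gamma>\<close>.\<close>

lemma root_reflection_word:
  assumes "\<alpha> \<in> \<Delta>"
  shows "\<exists>ls. set ls \<subseteq> \<Psi> \<and> root_reflection \<alpha> = reflection_word ls"
proof -
  have pos: "\<exists>ls. set ls \<subseteq> \<Psi> \<and> root_reflection \<alpha> = reflection_word ls" if "\<alpha> \<in> \<Delta>p" for \<alpha>
    using that
  proof (induction rule: positive_root_induct)
    case (simple \<beta>)
    thus ?case by (intro exI[of _ "[\<beta>]"]) auto
  next
    case (reflect \<beta> \<gamma>)
    then obtain ls where ls: "set ls \<subseteq> \<Psi>" "root_reflection (root_reflection \<beta> \<gamma>) = reflection_word ls"
      by blast
    have "root_reflection \<gamma> v = root_reflection \<beta> (root_reflection (root_reflection \<beta> \<gamma>) (root_reflection \<beta> v))" for v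
      using root_reflection_conj[OF orthogonal_transformation_root_reflection,
          of \<beta> "root_reflection \<beta> \<gamma>" "root_reflection \<beta> v"]
      by (simp only: root_reflection_involution)
    hence "root_reflection \<gamma> = reflection_word (\<beta> # ls @ [\<beta>])"
      by (simp add: reflection_word_append fun_eq_iff ls(2)[symmetric])
    thus ?case using ls(1) reflect.hyps(1) by (intro exI[of _ "\<beta> # ls @ [\<beta>]"]) auto
  qed
  show ?thesis
    using pos[of \<alpha>] pos[of "- \<alpha>"] assms roots_split negative_iff
    by (auto simp: root_reflection_minus)
qed

text \<open>Makes the generated group accessible to induction over lists of simple roots. Inverses
  of generators cost nothing because reflections are involutions.\<close>

lemma weyl_group_eq_words: "W = {reflection_word ls | ls. set ls \<subseteq> \<Psi>}"
proof -
  have Bij: "f \<in> Bij UNIV \<longleftrightarrow> bij f" for f :: "'a \<Rightarrow> 'a"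
    by (simp add: Bij_def)
  have mult: "f \<otimes>\<^bsub>BijGroup UNIV\<^esub> g = f \<circ> g" if "bij f" "bij g" for f g :: "'a \<Rightarrow> 'a"
    using that by (simp add: BijGroup_def Bij fun_eq_iff compose_def)
  have one: "\<one>\<^bsub>BijGroup UNIV\<^esub> = (id :: 'a \<Rightarrow> 'a)"
    by (simp add: BijGroup_def fun_eq_iff)
  show ?thesis
  proof (intro equalityI subsetI)
    fix w assume "w \<in> W"
    thus "w \<in> {reflection_word ls | ls. set ls \<subseteq> \<Psi>}"
      unfolding weyl_group_def
    proof (induction rule: generate.induct)
      case one
      show ?case by (auto simp: \<open>\<one>\<^bsub>BijGroup UNIV\<^esub> = id\<close> intro!: exI[of _ "[]"])
    next
      case (incl h)
      thus ?case using root_reflection_word by blast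
    next
      case (inv h)
      then obtain \<alpha> where \<alpha>: "\<alpha> \<in> \<Delta>" "h = root_reflection \<alpha>" by blast
      have "bij h" unfolding \<alpha> by (rule o_bij[OF root_reflection_comp_self root_reflection_comp_self])
      moreover have "inv_into UNIV h = h"
        unfolding \<alpha> by (rule inv_equality) (auto simp: root_reflection_involution)
      ultimately have "inv\<^bsub>BijGroup UNIV\<^esub> h = h"
        by (simp add: inv_BijGroup Bij restrict_def)
      thus ?case using root_reflection_word[OF \<alpha>(1)] \<alpha>(2) by auto
    next
      case (eng h1 h2)
      then obtain xs ys where "set xs \<subseteq> \<Psi>" "set ys \<subseteq> \<Psi>" "h1 = reflection_word xs" "h2 = reflection_word ys"
        by blast
      thus ?case
        by (auto simp: mult bij_reflection_word reflection_word_append intro!: exI[of _ "xs @ ys"])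
    qed
  next
    fix w assume "w \<in> {reflection_word ls | ls. set ls \<subseteq> \<Psi>}"
    then obtain ls where "set ls \<subseteq> \<Psi>" "w = reflection_word ls" by blast
    thus "w \<in> W"
    proof (induction ls arbitrary: w)
      case Nil
      thus ?case using generate.one[of "BijGroup UNIV" "root_reflection ` \<Delta>"]
        by (simp only: one weyl_group_def reflection_word_simps)
    next
      case (Cons \<beta> ls)
      have "root_reflection \<beta> \<otimes>\<^bsub>BijGroup UNIV\<^esub> reflection_word ls \<in> W"
        unfolding weyl_group_def
        by (rule generate.eng[OF generate.incl])
           (use Cons simple_root in \<open>auto simp: weyl_group_def\<close>)
      moreover have "bij (root_reflection \<beta>)"
        by (rule o_bij[OF root_reflection_comp_self root_reflection_comp_self])
      ultimately show ?case by (simp only: Cons.prems mult bij_reflection_word reflection_word_simps)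
    qed
  qed
qed

lemma weyl_orthogonal: "w \<in> W \<Longrightarrow> orthogonal_transformation w"
  and weyl_bij: "w \<in> W \<Longrightarrow> bij w"
  and weyl_root: "w \<in> W \<Longrightarrow> \<alpha> \<in> \<Delta> \<Longrightarrow> w \<alpha> \<in> \<Delta>"
  unfolding weyl_group_eq_words
  using orthogonal_reflection_word bij_reflection_word reflection_word_root by auto

lemma weyl_inner: "w \<in> W \<Longrightarrow> w u \<bullet> w v = u \<bullet> v"
  using weyl_orthogonal by (auto simp: orthogonal_transformation_def)

lemma weyl_linear: "w \<in> W \<Longrightarrow> linear w"
  using weyl_orthogonal by (auto simp: orthogonal_transformation_def)

lemma weyl_id: "id \<in> W"
  unfolding weyl_group_eq_words by (auto intro!: exI[of _ "[]"])

lemma weyl_comp: "w \<in> W \<Longrightarrow> w' \<in> W \<Longrightarrow> w \<circ> w' \<in> W"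
  unfolding weyl_group_eq_words
  by clarify (rule_tac x="ls @ lsa" in exI, simp add: reflection_word_append)

lemma weyl_inv: "w \<in> W \<Longrightarrow> inv_into UNIV w \<in> W"
  unfolding weyl_group_eq_words
proof clarify
  fix ls assume "set ls \<subseteq> \<Psi>"
  moreover have "inv_into UNIV (reflection_word ls) = reflection_word (rev ls)"
    using reflection_word_rev[of ls] reflection_word_rev'[of ls]
    by (intro inv_equality) (auto simp: fun_eq_iff)
  ultimately show "\<exists>lsa. inv_into UNIV (reflection_word ls) = reflection_word lsa \<and> set lsa \<subseteq> \<Psi>"
    by (intro exI[of _ "rev ls"]) auto
qed

lemma simple_reflection_weyl: "\<beta> \<in> \<Psi> \<Longrightarrow> root_reflection \<beta> \<in> W"
  unfolding weyl_group_eq_words by (auto intro!: exI[of _ "[\<beta>]"])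

lemma weyl_inv_inner: "w \<in> W \<Longrightarrow> inv_into UNIV w u \<bullet> v = u \<bullet> w v"
  using weyl_inner[of w "inv_into UNIV w u" v] weyl_bij[of w] by (simp add: bij_is_surj surj_f_inv_f)

text \<open>Linear maps agreeing on a spanning set coincide, so \<open>W\<close> embeds into the
  self-maps of the finite set \<open>\<Delta>\<close>.\<close>

lemma finite_weyl: "finite W"
proof (rule finite_imageD)
  show "finite ((\<lambda>w. restrict w \<Delta>) ` W)"
  proof (rule finite_subset)
    show "(\<lambda>w. restrict w \<Delta>) ` W \<subseteq> (\<Pi>\<^sub>E \<alpha>\<in>\<Delta>. \<Delta>)"
      using weyl_root by (intro image_subsetI) (simp add: restrict_PiE_iff)
    show "finite (\<Pi>\<^sub>E \<alpha>\<in>\<Delta>. \<Delta>)"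
      by (intro finite_PiE finite_roots)
  qed
  show "inj_on (\<lambda>w. restrict w \<Delta>) W"
  proof (rule inj_onI)
    fix w w' assume w: "w \<in> W" "w' \<in> W" and "restrict w \<Delta> = restrict w' \<Delta>"
    hence eq: "w \<alpha> = w' \<alpha>" if "\<alpha> \<in> \<Delta>" for \<alpha> using that by (metis restrict_apply')
    show "w = w'"
    proof
      fix v
      show "w v = w' v"
        by (rule linear_eq_on_span[OF weyl_linear[OF w(1)] weyl_linear[OF w(2)] eq])
           (assumption, use span_roots in blast)
    qed
  qed
qed

section \<open>Integrality tests for the lattices, dominance and the action on weights\<close>

lemma weight_lattice_iff: "v \<in> weight_lattice \<Psi> \<longleftrightarrow> (\<forall>\<beta>\<in>\<Psi>. coroot \<beta> \<bullet> v \<in> \<int>)"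
  unfolding weight_lattice_def by (rule int_span_iff[OF dual_bases_sym[OF dual_coroot_weight]])

lemma root_lattice_iff: "v \<in> root_lattice \<Psi> \<longleftrightarrow> (\<forall>\<beta>\<in>\<Psi>. coweight \<beta> \<bullet> v \<in> \<int>)"
  unfolding root_lattice_def by (rule int_span_iff[OF dual_root_coweight])

lemma coroot_lattice_iff: "v \<in> coroot_lattice \<Psi> \<longleftrightarrow> (\<forall>\<beta>\<in>\<Psi>. weight \<beta> \<bullet> v \<in> \<int>)"
  unfolding coroot_lattice_def by (rule int_span_iff[OF dual_coroot_weight])

lemma coweight_lattice_iff: "v \<in> coweight_lattice \<Psi> \<longleftrightarrow> (\<forall>\<beta>\<in>\<Psi>. \<beta> \<bullet> v \<in> \<int>)"
  unfolding coweight_lattice_def by (rule int_span_iff[OF dual_bases_sym[OF dual_root_coweight]])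

lemma strictly_dominant_iff:
  "v \<in> strictly_dominant_weights \<Psi> \<longleftrightarrow> v \<in> weight_lattice \<Psi> \<and> (\<forall>\<beta>\<in>\<Psi>. coroot \<beta> \<bullet> v > 0)"
proof
  assume "v \<in> strictly_dominant_weights \<Psi>"
  then obtain m :: "'a \<Rightarrow> nat" where m: "\<forall>\<alpha>\<in>\<Psi>. m \<alpha> \<ge> 1"
    and v: "v = (\<Sum>\<alpha>\<in>\<Psi>. real (m \<alpha>) *\<^sub>R weight \<alpha>)"
    unfolding strictly_dominant_weights_def by auto
  have "coroot \<beta> \<bullet> v = real (m \<beta>)" if "\<beta> \<in> \<Psi>" for \<beta>
    unfolding v using dual_bases_inner_sum[OF dual_bases_sym[OF dual_coroot_weight] that] .
  thus "v \<in> weight_lattice \<Psi> \<and> (\<forall>\<beta>\<in>\<Psi>. coroot \<beta> \<bullet> v > 0)"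
    unfolding weight_lattice_iff using m by force
next
  assume v: "v \<in> weight_lattice \<Psi> \<and> (\<forall>\<beta>\<in>\<Psi>. coroot \<beta> \<bullet> v > 0)"
  define m where "m \<beta> = nat \<lfloor>coroot \<beta> \<bullet> v\<rfloor>" for \<beta>
  have m: "coroot \<beta> \<bullet> v = real (m \<beta>) \<and> m \<beta> \<ge> 1" if "\<beta> \<in> \<Psi>" for \<beta>
  proof -
    have "coroot \<beta> \<bullet> v \<in> \<int>" "coroot \<beta> \<bullet> v > 0"
      using v that unfolding weight_lattice_iff by blast+
    then obtain n where "coroot \<beta> \<bullet> v = of_int n" "n > 0"
      by (metis Ints_cases of_int_0_less_iff)
    thus ?thesis by (simp add: m_def)
  qed
  have "v = (\<Sum>\<beta>\<in>\<Psi>. (coroot \<beta> \<bullet> v) *\<^sub>R weight \<beta>)" by (rule weight_expand)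
  also have "\<dots> = (\<Sum>\<beta>\<in>\<Psi>. real (m \<beta>) *\<^sub>R weight \<beta>)" using m by (intro sum.cong) auto
  finally show "v \<in> strictly_dominant_weights \<Psi>"
    unfolding strictly_dominant_weights_def using m by auto
qed

text \<open>A positive root is a nonzero combination of simple roots with nonnegative coefficients,
  and each simple root pairs positively with \<open>v\<close>.\<close>

lemma coroot_strictly_dominant_pos:
  assumes "\<alpha> \<in> \<Delta>p" "v \<in> strictly_dominant_weights \<Psi>"
  shows "coroot \<alpha> \<bullet> v > 0"
proof -
  have \<beta>v: "\<beta> \<bullet> v > 0" if "\<beta> \<in> \<Psi>" for \<beta>
  proof -
    have "coroot \<beta> \<bullet> v > 0" using assms(2) that unfolding strictly_dominant_iff by blast
    moreover have "\<beta> \<bullet> \<beta> > 0" using root_neq_0[OF simple_root[OF that]] by simp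
    ultimately show ?thesis by (simp add: coroot_def zero_less_divide_iff)
  qed
  have "\<exists>\<beta>\<in>\<Psi>. coweight \<beta> \<bullet> \<alpha> \<noteq> 0"
    using simple_expand[of \<alpha>] root_neq_0[OF positive_root[OF assms(1)]] by (auto intro: ccontr)
  then obtain \<beta> where "\<beta> \<in> \<Psi>" "coweight \<beta> \<bullet> \<alpha> > 0"
    using positive_coweight_ge_0[OF assms(1)] by force
  hence "(\<Sum>\<beta>\<in>\<Psi>. (coweight \<beta> \<bullet> \<alpha>) * (\<beta> \<bullet> v)) > 0"
    using \<beta>v positive_coweight_ge_0[OF assms(1)] finite_simple
    by (intro sum_pos2[of _ \<beta>]) (auto intro!: mult_nonneg_nonneg intro: less_imp_le)
  moreover have "\<alpha> \<bullet> v = (\<Sum>\<beta>\<in>\<Psi>. (coweight \<beta> \<bullet> \<alpha>) * (\<beta> \<bullet> v))"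
    by (subst simple_expand[of \<alpha>]) (simp add: inner_sum_left)
  ultimately show ?thesis
    using root_neq_0[OF positive_root[OF assms(1)]] by (simp add: coroot_def)
qed

lemma root_lattice_subset: "v \<in> root_lattice \<Psi> \<Longrightarrow> v \<in> weight_lattice \<Psi>"
proof -
  assume v: "v \<in> root_lattice \<Psi>"
  have "coroot \<beta> \<bullet> v \<in> \<int>" if "\<beta> \<in> \<Psi>" for \<beta>
  proof -
    have "coroot \<beta> \<bullet> v = (\<Sum>\<gamma>\<in>\<Psi>. (coweight \<gamma> \<bullet> v) * (coroot \<beta> \<bullet> \<gamma>))"
      by (subst simple_expand[of v]) (simp add: inner_sum_right)
    also have "\<dots> \<in> \<int>"
      using v that coroot_root_Ints simple_root by (intro Ints_sum Ints_mult) (auto simp: root_lattice_iff)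
    finally show ?thesis .
  qed
  thus ?thesis by (simp add: weight_lattice_iff)
qed

lemma weight_lattice_add: "u \<in> weight_lattice \<Psi> \<Longrightarrow> v \<in> weight_lattice \<Psi> \<Longrightarrow> u + v \<in> weight_lattice \<Psi>"
  by (simp add: weight_lattice_iff inner_add_right)

text \<open>Each letter subtracts an integral multiple of a simple root. So \<open>W\<close> acts
  trivially on the quotient \<open>P / Q\<close>, and class functions are invariant under
  it.\<close>

lemma weyl_weight_diff:
  assumes "w \<in> W" "v \<in> weight_lattice \<Psi>"
  shows "w v - v \<in> root_lattice \<Psi>" and "w v \<in> weight_lattice \<Psi>"
proof -
  obtain ls where "set ls \<subseteq> \<Psi>" "w = reflection_word ls"
    using assms(1) unfolding weyl_group_eq_words by blast
  thus *: "w v - v \<in> root_lattice \<Psi>"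
  proof (induction ls arbitrary: w)
    case Nil
    thus ?case by (simp add: root_lattice_iff)
  next
    case (Cons \<beta> ls)
    let ?u = "reflection_word ls v"
    have u: "?u - v \<in> root_lattice \<Psi>" using Cons by simp
    have "(?u - v) + v \<in> weight_lattice \<Psi>"
      by (rule weight_lattice_add[OF root_lattice_subset[OF u] assms(2)])
    hence "coroot \<beta> \<bullet> ?u \<in> \<int>" using Cons.prems(1) by (simp add: weight_lattice_iff)
    hence "coweight \<gamma> \<bullet> (?u - v) - (coroot \<beta> \<bullet> ?u) * (coweight \<gamma> \<bullet> \<beta>) \<in> \<int>" if "\<gamma> \<in> \<Psi>" for \<gamma>
      using u that Cons.prems(1) by (intro Ints_diff Ints_mult) (auto simp: root_lattice_iff coweight_simple)
    thus ?case using Cons.prems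
      by (simp add: root_lattice_iff inner_diff_right inner_root_reflection algebra_simps)
  qed
  have "(w v - v) + v \<in> weight_lattice \<Psi>"
    by (rule weight_lattice_add[OF root_lattice_subset[OF *] assms(2)])
  thus "w v \<in> weight_lattice \<Psi>" by simp
qed

section \<open>Simple transitivity of the Weyl group on chambers\<close>

text \<open>The quotient \<open>u\<close> of \<open>w\<close> by \<open>w'\<close> takes one
  strictly dominant weight to another. Since it preserves pairings, the sign of the image of a
  simple root can be tested on the image weight; hence simple roots stay positive and
  \<open>u\<close> is the identity.\<close>

lemma weyl_chamber_inj:
  assumes w: "w \<in> W" "w' \<in> W" and \<nu>: "\<nu> \<in> strictly_dominant_weights \<Psi>" "\<nu>' \<in> strictly_dominant_weights \<Psi>"
    and eq: "w \<nu> = w' \<nu>'"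
  shows "w = w'"
proof -
  define u where "u = inv_into UNIV w' \<circ> w"
  have u: "u \<in> W" unfolding u_def using w by (intro weyl_comp weyl_inv)
  have u\<nu>: "u \<nu> = \<nu>'"
    using weyl_bij[OF w(2)] eq by (simp add: u_def bij_is_inj inv_f_f)
  have "u \<beta> \<in> \<Delta>p" if "\<beta> \<in> \<Psi>" for \<beta>
  proof (rule ccontr)
    assume "u \<beta> \<notin> \<Delta>p"
    hence "- u \<beta> \<in> \<Delta>p"
      using weyl_root[OF u simple_root[OF that]] roots_split negative_iff by blast
    from coroot_strictly_dominant_pos[OF this \<nu>(2)] have "coroot (u \<beta>) \<bullet> u \<nu> < 0"
      by (simp add: coroot_minus u\<nu>)
    moreover have "coroot (u \<beta>) \<bullet> u \<nu> = coroot \<beta> \<bullet> \<nu>"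
      by (simp add: coroot_orthogonal[OF weyl_orthogonal[OF u]] weyl_inner[OF u])
    ultimately show False
      using coroot_strictly_dominant_pos[OF simple_positive[OF that] \<nu>(1)] by simp
  qed
  hence "u = id"
    using u reflection_word_preserving_positive unfolding weyl_group_eq_words by blast
  hence "w' \<circ> u = w'" by simp
  moreover have "w' \<circ> u = w"
    unfolding u_def using weyl_bij[OF w(2)] by (simp add: fun_eq_iff bij_is_surj surj_f_inv_f)
  ultimately show ?thesis by simp
qed

text \<open>Among the finitely many images of \<open>v\<close>, one that is highest in the direction
  \<open>\<rho>\<close> is dominant: if it paired negatively with a simple coroot, reflecting would
  raise it further.\<close>

lemma weyl_chamber_surj:
  assumes v: "v \<in> weight_lattice \<Psi>" and reg: "\<And>\<alpha>. \<alpha> \<in> \<Delta>p \<Longrightarrow> coroot \<alpha> \<bullet> v \<noteq> 0"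
  shows "\<exists>w\<in>W. \<exists>\<nu>\<in>strictly_dominant_weights \<Psi>. v = w \<nu>"
proof -
  \<comment> \<open>This vector pairs to 1 with every simple root, so a simple reflection changes
    the height of \<open>w v\<close> by exactly \<open>coroot \<beta> \<bullet> w v\<close>, with a
    minus sign.\<close>
  define \<rho> where "\<rho> = (\<Sum>\<beta>\<in>\<Psi>. coweight \<beta>)"
  have \<rho>: "\<rho> \<bullet> \<beta> = 1" if "\<beta> \<in> \<Psi>" for \<beta>
    using that finite_simple by (simp add: \<rho>_def inner_sum_left coweight_simple)
  have "Max ((\<lambda>w. \<rho> \<bullet> w v) ` W) \<in> (\<lambda>w. \<rho> \<bullet> w v) ` W"
    using finite_weyl weyl_id by (intro Max_in) auto
  then obtain w where w: "w \<in> W" "Max ((\<lambda>w. \<rho> \<bullet> w v) ` W) = \<rho> \<bullet> w v" by blast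
  have max: "\<rho> \<bullet> w' v \<le> \<rho> \<bullet> w v" if "w' \<in> W" for w'
    unfolding w(2)[symmetric] using that finite_weyl by (intro Max_ge) auto
  have "coroot \<beta> \<bullet> w v > 0" if \<beta>: "\<beta> \<in> \<Psi>" for \<beta>
  proof -
    have "coroot \<beta> \<bullet> w v \<ge> 0"
      using max[OF weyl_comp[OF simple_reflection_weyl[OF \<beta>] w(1)]] \<rho>[OF \<beta>]
      by (simp add: inner_root_reflection)
    moreover have "coroot \<beta> \<bullet> w v \<noteq> 0"
    proof
      assume 0: "coroot \<beta> \<bullet> w v = 0"
      \<comment> \<open>A wall through \<open>w v\<close> pulls back to a wall through
        \<open>v\<close>, contradicting regularity.\<close>
      let ?\<gamma> = "inv_into UNIV w \<beta>"
      have "coroot ?\<gamma> \<bullet> v = 0"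
        using 0 by (simp add: coroot_orthogonal[OF weyl_orthogonal[OF weyl_inv[OF w(1)]]] weyl_inv_inner[OF w(1)])
      moreover have "?\<gamma> \<in> \<Delta>p \<or> - ?\<gamma> \<in> \<Delta>p"
        using weyl_root[OF weyl_inv[OF w(1)] simple_root[OF \<beta>]] roots_split negative_iff by blast
      ultimately show False using reg[of ?\<gamma>] reg[of "- ?\<gamma>"] by (auto simp: coroot_minus)
    qed
    ultimately show ?thesis by simp
  qed
  hence "w v \<in> strictly_dominant_weights \<Psi>"
    using weyl_weight_diff(2)[OF w(1) v] by (simp add: strictly_dominant_iff)
  moreover have "v = inv_into UNIV w (w v)" using weyl_bij[OF w(1)] by (simp add: bij_is_inj inv_f_f)
  ultimately show ?thesis using weyl_inv[OF w(1)] by blast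
qed

end

section \<open>Fourier inversion on the weight lattice modulo the root lattice\<close>

definition additive_subgroup :: "'a::euclidean_space set \<Rightarrow> bool" where
  "additive_subgroup L \<longleftrightarrow> 0 \<in> L \<and> (\<forall>x\<in>L. \<forall>y\<in>L. x - y \<in> L)"

lemma additive_subgroup_add:
  assumes "additive_subgroup L" "x \<in> L" "y \<in> L"
  shows "x + y \<in> L"
proof -
  have "0 - y \<in> L" using assms unfolding additive_subgroup_def by blast
  hence "x - (0 - y) \<in> L" using assms unfolding additive_subgroup_def by blast
  thus ?thesis by simp
qed

lemma additive_subgroup_minus: "additive_subgroup L \<Longrightarrow> x \<in> L \<Longrightarrow> - x \<in> L"
  unfolding additive_subgroup_def by (metis diff_0)

lemma additive_subgroup_int_span:
  assumes "dual_bases \<Psi> b b'"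
  shows "additive_subgroup (int_span \<Psi> b)"
  unfolding additive_subgroup_def by (auto simp: int_span_iff[OF assms] inner_diff_right)

section \<open>Quotients of lattices and their character sums\<close>

locale lattice_pair =
  fixes L M :: "'a::euclidean_space set"
  assumes L: "additive_subgroup L" and M: "additive_subgroup M"
begin

definition coset :: "'a \<Rightarrow> 'a set" where
  "coset x = {y \<in> L. x - y \<in> M}"

lemma cosets_eq: "cosets L M = coset ` L"
  unfolding cosets_def quotient_def coset_def by auto

lemma coset_in_cosets: "x \<in> L \<Longrightarrow> coset x \<in> cosets L M"
  by (simp add: cosets_eq)

lemma coset_rep_coset:
  assumes "x \<in> L"
  shows "coset_rep (coset x) \<in> L" "x - coset_rep (coset x) \<in> M"
proof -
  have "x \<in> coset x" using assms M by (simp add: coset_def additive_subgroup_def)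
  hence "coset_rep (coset x) \<in> coset x" unfolding coset_rep_def by (rule someI)
  thus "coset_rep (coset x) \<in> L" "x - coset_rep (coset x) \<in> M" by (simp_all add: coset_def)
qed

lemma coset_eq_iff:
  assumes "x \<in> L" "y \<in> L"
  shows "coset x = coset y \<longleftrightarrow> x - y \<in> M"
proof
  assume "coset x = coset y"
  moreover have "y \<in> coset y" using assms M by (simp add: coset_def additive_subgroup_def)
  ultimately have "y \<in> coset x" by (simp only:)
  thus "x - y \<in> M" by (simp add: coset_def)
next
  assume xy: "x - y \<in> M"
  have "x - z \<in> M \<longleftrightarrow> y - z \<in> M" for z
  proof
    assume "x - z \<in> M"
    hence "(x - z) - (x - y) \<in> M" using xy M unfolding additive_subgroup_def by blast
    thus "y - z \<in> M" by simp
  next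
    assume "y - z \<in> M"
    hence "(x - y) + (y - z) \<in> M" using xy by (intro additive_subgroup_add[OF M])
    thus "x - z \<in> M" by simp
  qed
  thus "coset x = coset y" by (simp add: coset_def)
qed

lemma coset_rep_in: "C \<in> cosets L M \<Longrightarrow> coset_rep C \<in> L"
  using coset_rep_coset by (auto simp: cosets_eq)

lemma coset_coset_rep:
  assumes "C \<in> cosets L M"
  shows "coset (coset_rep C) = C"
proof -
  obtain x where "x \<in> L" "C = coset x" using assms by (auto simp: cosets_eq)
  thus ?thesis using coset_rep_coset[of x] coset_eq_iff[of x "coset_rep C"] by simp
qed

text \<open>If the character is not 1 at some \<open>l\<close>, translating by \<open>l\<close>
  permutes the cosets but multiplies the sum by a number other than 1, so the sum vanishes.
  Triviality on \<open>M\<close> makes the choice of representatives immaterial.\<close>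

lemma coset_character_sum:
  assumes \<nu>: "\<And>m. m \<in> M \<Longrightarrow> m \<bullet> \<nu> \<in> \<int>"
  shows "(\<Sum>C\<in>cosets L M. e2pi (coset_rep C \<bullet> \<nu>)) =
         (if \<forall>l\<in>L. l \<bullet> \<nu> \<in> \<int> then of_nat (card (cosets L M)) else 0)"
proof (cases "\<forall>l\<in>L. l \<bullet> \<nu> \<in> \<int>")
  case True
  hence "(\<Sum>C\<in>cosets L M. e2pi (coset_rep C \<bullet> \<nu>)) = (\<Sum>C\<in>cosets L M. 1)"
    using coset_rep_in by (intro sum.cong) (auto simp: e2pi_eq_1_iff)
  thus ?thesis using True by simp
next
  case False
  then obtain l where l: "l \<in> L" "e2pi (l \<bullet> \<nu>) \<noteq> 1" by (auto simp: e2pi_eq_1_iff)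
  let ?S = "\<Sum>C\<in>cosets L M. e2pi (coset_rep C \<bullet> \<nu>)"
  have neg_l: "- l \<in> L" using l(1) by (rule additive_subgroup_minus[OF L])
  have add_L: "x + y \<in> L" if "x \<in> L" "y \<in> L" for x y
    using that by (rule additive_subgroup_add[OF L])
  \<comment> \<open>Passing to a chosen representative loses only an element of \<open>M\<close>, so
    translations compose and translation by \<open>- l\<close> undoes translation by
    \<open>l\<close>.\<close>
  have shift: "coset (coset_rep (coset (x + y)) + z) = coset (x + y + z)" if "x \<in> L" "y \<in> L" "z \<in> L" for x y z
  proof -
    have "- (x + y - coset_rep (coset (x + y))) \<in> M"
      using that add_L by (intro additive_subgroup_minus[OF M] coset_rep_coset)
    thus ?thesis using that add_L coset_rep_coset
      by (subst coset_eq_iff) auto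
  qed
  have "?S = (\<Sum>C\<in>cosets L M. e2pi (coset_rep (coset (coset_rep C + l)) \<bullet> \<nu>))"
  proof (rule sum.reindex_bij_witness[of _ "\<lambda>C. coset (coset_rep C + l)" "\<lambda>C. coset (coset_rep C + - l)"])
    fix C assume C: "C \<in> cosets L M"
    have r: "coset_rep C \<in> L" by (rule coset_rep_in[OF C])
    show "coset (coset_rep (coset (coset_rep C + - l)) + l) = C"
      using shift[OF r neg_l l(1)] coset_coset_rep[OF C] by simp
    show "coset (coset_rep C + - l) \<in> cosets L M"
      by (intro coset_in_cosets add_L r neg_l)
    show "coset (coset_rep (coset (coset_rep C + l)) + - l) = C"
      using shift[OF r l(1) neg_l] coset_coset_rep[OF C] by simp
    show "coset (coset_rep C + l) \<in> cosets L M"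
      by (intro coset_in_cosets add_L r l)
    show "e2pi (coset_rep (coset (coset_rep (coset (coset_rep C + - l)) + l)) \<bullet> \<nu>) = e2pi (coset_rep C \<bullet> \<nu>)"
      using shift[OF r neg_l l(1)] coset_coset_rep[OF C] by simp
  qed
  also have "\<dots> = (\<Sum>C\<in>cosets L M. e2pi (coset_rep C \<bullet> \<nu>) * e2pi (l \<bullet> \<nu>))"
  proof (intro sum.cong refl)
    fix C assume C: "C \<in> cosets L M"
    have "(coset_rep C + l - coset_rep (coset (coset_rep C + l))) \<bullet> \<nu> \<in> \<int>"
      by (intro \<nu> coset_rep_coset add_L coset_rep_in[OF C] l)
    hence "(coset_rep C + l) \<bullet> \<nu> - coset_rep (coset (coset_rep C + l)) \<bullet> \<nu> \<in> \<int>"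
      by (simp add: inner_diff_left)
    thus "e2pi (coset_rep (coset (coset_rep C + l)) \<bullet> \<nu>) = e2pi (coset_rep C \<bullet> \<nu>) * e2pi (l \<bullet> \<nu>)"
      by (simp add: e2pi_cong_int[symmetric] inner_add_left e2pi_add)
  qed
  also have "\<dots> = ?S * e2pi (l \<bullet> \<nu>)" by (simp add: sum_distrib_right)
  finally have "?S = 0" using l(2) by simp
  thus ?thesis using False by (simp only: if_False)
qed

end

text \<open>Removing the integral parts of the \<open>b\<close>-coordinates moves an element into
  the fundamental parallelepiped of the smaller lattice, where norms are at most \<open>R\<close>. A
  ball contains finitely many points of the larger lattice, since Cauchy-Schwarz bounds their
  integer coordinates.\<close>

lemma finite_cosets_int_span:
  assumes b: "dual_bases \<Psi> b b'" and c: "dual_bases \<Psi> c c'" and sub: "int_span \<Psi> b \<subseteq> int_span \<Psi> c"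
  shows "finite (cosets (int_span \<Psi> c) (int_span \<Psi> b))"
proof -
  interpret lattice_pair "int_span \<Psi> c" "int_span \<Psi> b"
    using b c by unfold_locales (auto intro: additive_subgroup_int_span)
  have fin: "finite \<Psi>" using b by (simp add: dual_bases_def)
  define R where "R = (\<Sum>\<beta>\<in>\<Psi>. norm (b \<beta>))"
  define F where "F = {x \<in> int_span \<Psi> c. norm x \<le> R}"
  have "finite F"
  proof (rule finite_subset)
    define N where "N \<beta> = {n::int. \<bar>of_int n\<bar> \<le> norm (c' \<beta>) * R}" for \<beta>
    show "F \<subseteq> (\<lambda>n. \<Sum>\<beta>\<in>\<Psi>. of_int (n \<beta>) *\<^sub>R c \<beta>) ` (\<Pi>\<^sub>E \<beta>\<in>\<Psi>. N \<beta>)"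
    proof
      fix x assume x: "x \<in> F"
      define n where "n = restrict (\<lambda>\<beta>. \<lfloor>c' \<beta> \<bullet> x\<rfloor>) \<Psi>"
      have n: "of_int (n \<beta>) = c' \<beta> \<bullet> x" if "\<beta> \<in> \<Psi>" for \<beta>
        using x that by (auto simp: n_def F_def int_span_iff[OF c] elim!: Ints_cases dest!: bspec[of \<Psi> _ \<beta>])
      have "x = (\<Sum>\<beta>\<in>\<Psi>. (c' \<beta> \<bullet> x) *\<^sub>R c \<beta>)"
        by (rule dual_bases_expand[OF dual_bases_sym[OF c]])
      also have "\<dots> = (\<Sum>\<beta>\<in>\<Psi>. of_int (n \<beta>) *\<^sub>R c \<beta>)" using n by (intro sum.cong) auto
      finally have eq: "x = (\<Sum>\<beta>\<in>\<Psi>. of_int (n \<beta>) *\<^sub>R c \<beta>)" .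
      have "n \<beta> \<in> N \<beta>" if "\<beta> \<in> \<Psi>" for \<beta>
      proof -
        have "\<bar>c' \<beta> \<bullet> x\<bar> \<le> norm (c' \<beta>) * norm x" by (rule Cauchy_Schwarz_ineq2)
        also have "\<dots> \<le> norm (c' \<beta>) * R" using x by (intro mult_left_mono) (auto simp: F_def)
        finally show ?thesis using n[OF that] by (simp add: N_def)
      qed
      hence "n \<in> (\<Pi>\<^sub>E \<beta>\<in>\<Psi>. N \<beta>)" by (auto simp: n_def)
      thus "x \<in> (\<lambda>n. \<Sum>\<beta>\<in>\<Psi>. of_int (n \<beta>) *\<^sub>R c \<beta>) ` (\<Pi>\<^sub>E \<beta>\<in>\<Psi>. N \<beta>)" using eq by blast
    qed
    have "finite (N \<beta>)" for \<beta>
    proof (rule finite_subset)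
      show "N \<beta> \<subseteq> {-\<lceil>norm (c' \<beta>) * R\<rceil>..\<lceil>norm (c' \<beta>) * R\<rceil>}"
        unfolding N_def by (auto simp: abs_le_iff le_ceiling_iff) linarith+
    qed auto
    thus "finite ((\<lambda>n. \<Sum>\<beta>\<in>\<Psi>. of_int (n \<beta>) *\<^sub>R c \<beta>) ` (\<Pi>\<^sub>E \<beta>\<in>\<Psi>. N \<beta>))"
      by (intro finite_imageI finite_PiE fin)
  qed
  moreover have "cosets (int_span \<Psi> c) (int_span \<Psi> b) \<subseteq> coset ` F"
  proof
    fix C assume "C \<in> cosets (int_span \<Psi> c) (int_span \<Psi> b)"
    then obtain x where x: "x \<in> int_span \<Psi> c" "C = coset x" by (auto simp: cosets_eq)
    define q where "q = (\<Sum>\<beta>\<in>\<Psi>. of_int \<lfloor>b' \<beta> \<bullet> x\<rfloor> *\<^sub>R b \<beta>)"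
    have q: "q \<in> int_span \<Psi> b" by (auto simp: q_def int_span_def)
    have x': "x - q \<in> int_span \<Psi> c"
      using x(1) q sub L by (auto simp: additive_subgroup_def)
    have "x - q = (\<Sum>\<beta>\<in>\<Psi>. (b' \<beta> \<bullet> x) *\<^sub>R b \<beta>) - q"
      using dual_bases_expand[OF dual_bases_sym[OF b], of x] by simp
    also have "\<dots> = (\<Sum>\<beta>\<in>\<Psi>. frac (b' \<beta> \<bullet> x) *\<^sub>R b \<beta>)"
      by (simp add: q_def frac_def sum_subtractf scaleR_diff_left)
    also have "norm \<dots> \<le> (\<Sum>\<beta>\<in>\<Psi>. norm (b \<beta>))"
    proof (rule sum_norm_le)
      fix \<beta>
      have "norm (frac (b' \<beta> \<bullet> x) *\<^sub>R b \<beta>) = frac (b' \<beta> \<bullet> x) * norm (b \<beta>)" by simp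
      also have "\<dots> \<le> 1 * norm (b \<beta>)"
        using frac_lt_1[of "b' \<beta> \<bullet> x"] by (intro mult_right_mono) auto
      finally show "norm (frac (b' \<beta> \<bullet> x) *\<^sub>R b \<beta>) \<le> norm (b \<beta>)" by simp
    qed
    finally have "x - q \<in> F" using x' by (simp add: F_def R_def)
    moreover have "coset (x - q) = C"
      using x x' additive_subgroup_minus[OF M q] by (simp add: coset_eq_iff)
    ultimately show "C \<in> coset ` F" by blast
  qed
  ultimately show ?thesis by (meson finite_imageI finite_subset)
qed

section \<open>Duality between weights modulo roots and coweights modulo coroots\<close>

context root_basis
begin

abbreviation "P \<equiv> weight_lattice \<Psi>"
abbreviation "Q \<equiv> root_lattice \<Psi>"
abbreviation "P' \<equiv> coweight_lattice \<Psi>"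
abbreviation "Q' \<equiv> coroot_lattice \<Psi>"

lemma coroot_lattice_subset: "Q' \<subseteq> P'"
proof
  fix v assume v: "v \<in> Q'"
  have "\<beta> \<bullet> v \<in> \<int>" if "\<beta> \<in> \<Psi>" for \<beta>
  proof -
    have "v = (\<Sum>\<gamma>\<in>\<Psi>. (weight \<gamma> \<bullet> v) *\<^sub>R coroot \<gamma>)"
      by (rule dual_bases_expand[OF dual_bases_sym[OF dual_coroot_weight]])
    hence "\<beta> \<bullet> v = \<beta> \<bullet> (\<Sum>\<gamma>\<in>\<Psi>. (weight \<gamma> \<bullet> v) *\<^sub>R coroot \<gamma>)" by simp
    also have "\<dots> = (\<Sum>\<gamma>\<in>\<Psi>. (weight \<gamma> \<bullet> v) * (coroot \<gamma> \<bullet> \<beta>))"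
      by (simp add: inner_sum_right inner_commute)
    also have "\<dots> \<in> \<int>"
      using v that coroot_root_Ints simple_root by (intro Ints_sum Ints_mult) (auto simp: coroot_lattice_iff)
    finally show ?thesis .
  qed
  thus "v \<in> P'" by (simp add: coweight_lattice_iff)
qed

sublocale weights: lattice_pair P Q
  using additive_subgroup_int_span[OF dual_root_coweight]
    additive_subgroup_int_span[OF dual_bases_sym[OF dual_coroot_weight]]
  by unfold_locales (auto simp: weight_lattice_def root_lattice_def)

sublocale coweights: lattice_pair P' Q'
  using additive_subgroup_int_span[OF dual_coroot_weight]
    additive_subgroup_int_span[OF dual_bases_sym[OF dual_root_coweight]]
  by unfold_locales (auto simp: coweight_lattice_def coroot_lattice_def)

lemma finite_weight_cosets: "finite (cosets P Q)"
  using root_lattice_subset unfolding weight_lattice_def root_lattice_def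
  by (intro finite_cosets_int_span[OF dual_root_coweight dual_bases_sym[OF dual_coroot_weight]]) auto

lemma finite_coweight_cosets: "finite (cosets P' Q')"
  using coroot_lattice_subset unfolding coweight_lattice_def coroot_lattice_def
  by (intro finite_cosets_int_span[OF dual_coroot_weight dual_bases_sym[OF dual_root_coweight]]) auto

lemma coweight_lattice_pairing:
  assumes "\<mu> \<in> P'" "\<nu> \<in> Q"
  shows "\<mu> \<bullet> \<nu> \<in> \<int>"
proof -
  have "\<mu> \<bullet> \<nu> = (\<Sum>\<beta>\<in>\<Psi>. (coweight \<beta> \<bullet> \<nu>) * (\<beta> \<bullet> \<mu>))"
    by (subst simple_expand[of \<nu>]) (simp add: inner_sum_right inner_commute)
  also have "\<dots> \<in> \<int>"
    using assms by (intro Ints_sum Ints_mult) (auto simp: coweight_lattice_iff root_lattice_iff)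
  finally show ?thesis .
qed

lemma weight_lattice_pairing:
  assumes "\<mu> \<in> Q'" "\<nu> \<in> P"
  shows "\<mu> \<bullet> \<nu> \<in> \<int>"
proof -
  have "\<mu> \<bullet> \<nu> = (\<Sum>\<beta>\<in>\<Psi>. (coroot \<beta> \<bullet> \<nu>) * (weight \<beta> \<bullet> \<mu>))"
    by (subst weight_expand[of \<nu>]) (simp add: inner_sum_right inner_commute)
  also have "\<dots> \<in> \<int>"
    using assms by (intro Ints_sum Ints_mult) (auto simp: weight_lattice_iff coroot_lattice_iff)
  finally show ?thesis .
qed

text \<open>Testing against fundamental coweights reads off the simple coordinates. With the
  analogous fact for \<open>Q'\<close>, the pairing of the two finite quotients is
  nondegenerate.\<close>

lemma root_lattice_dual: "(\<forall>\<mu>\<in>P'. \<mu> \<bullet> \<nu> \<in> \<int>) \<longleftrightarrow> \<nu> \<in> Q"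
proof
  assume *: "\<forall>\<mu>\<in>P'. \<mu> \<bullet> \<nu> \<in> \<int>"
  have "coweight \<beta> \<in> P'" if "\<beta> \<in> \<Psi>" for \<beta>
    using coweight_simple that by (auto simp: coweight_lattice_iff inner_commute)
  thus "\<nu> \<in> Q" using * by (simp add: root_lattice_iff)
qed (use coweight_lattice_pairing in blast)

lemma coroot_lattice_dual: "(\<forall>\<nu>\<in>P. \<nu> \<bullet> \<mu> \<in> \<int>) \<longleftrightarrow> \<mu> \<in> Q'"
proof
  assume *: "\<forall>\<nu>\<in>P. \<nu> \<bullet> \<mu> \<in> \<int>"
  have "weight \<beta> \<in> P" if "\<beta> \<in> \<Psi>" for \<beta>
    using dual_coroot_weight that by (auto simp: weight_lattice_iff dual_bases_def)
  thus "\<mu> \<in> Q'" using * by (simp add: coroot_lattice_iff)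
qed (use weight_lattice_pairing inner_commute in metis)

lemma coweight_character_sum:
  assumes "\<nu> \<in> P"
  shows "(\<Sum>D\<in>cosets P' Q'. e2pi (coset_rep D \<bullet> \<nu>)) = (if \<nu> \<in> Q then of_nat (card (cosets P' Q')) else 0)"
  using coweights.coset_character_sum[of \<nu>] weight_lattice_pairing assms root_lattice_dual by simp

lemma weight_character_sum:
  assumes "\<mu> \<in> P'"
  shows "(\<Sum>C\<in>cosets P Q. e2pi (\<mu> \<bullet> coset_rep C)) = (if \<mu> \<in> Q' then of_nat (card (cosets P Q)) else 0)"
  using weights.coset_character_sum[of \<mu>] coweight_lattice_pairing[OF assms] coroot_lattice_dual
  by (simp add: inner_commute)

lemma (in lattice_pair) coset_rep_mem_iff:
  assumes "C \<in> cosets L M" "x \<in> L"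
  shows "x - coset_rep C \<in> M \<longleftrightarrow> C = coset x"
  using assms coset_eq_iff[OF assms(2) coset_rep_in[OF assms(1)]] coset_coset_rep[OF assms(1)] by auto

text \<open>Both sides count the pairs of cosets weighted by the value of the pairing, summed in either order.\<close>

lemma card_cosets_eq: "card (cosets P Q) = card (cosets P' Q')"
proof -
  let ?S = "\<Sum>C\<in>cosets P Q. \<Sum>D\<in>cosets P' Q'. e2pi (coset_rep D \<bullet> coset_rep C)"
  have zero: "0 \<in> P" "0 \<in> P'" using weights.L coweights.L by (auto simp: additive_subgroup_def)
  have "?S = (\<Sum>C\<in>cosets P Q. if C = weights.coset 0 then of_nat (card (cosets P' Q')) else 0)"
  proof (intro sum.cong refl)
    fix C assume C: "C \<in> cosets P Q"
    have "coset_rep C \<in> Q \<longleftrightarrow> 0 - coset_rep C \<in> Q"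
      using additive_subgroup_minus[OF weights.M] by (metis diff_0 minus_minus)
    thus "(\<Sum>D\<in>cosets P' Q'. e2pi (coset_rep D \<bullet> coset_rep C)) =
        (if C = weights.coset 0 then of_nat (card (cosets P' Q')) else 0)"
      using weights.coset_rep_mem_iff[OF C zero(1)] coweight_character_sum[OF weights.coset_rep_in[OF C]]
      by simp
  qed
  also have "\<dots> = of_nat (card (cosets P' Q'))"
    using finite_weight_cosets weights.coset_in_cosets[OF zero(1)] by simp
  finally have 1: "?S = of_nat (card (cosets P' Q'))" .
  have "?S = (\<Sum>D\<in>cosets P' Q'. \<Sum>C\<in>cosets P Q. e2pi (coset_rep D \<bullet> coset_rep C))"
    by (rule sum.swap)
  also have "\<dots> = (\<Sum>D\<in>cosets P' Q'. if D = coweights.coset 0 then of_nat (card (cosets P Q)) else 0)"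
  proof (intro sum.cong refl)
    fix D assume D: "D \<in> cosets P' Q'"
    have "coset_rep D \<in> Q' \<longleftrightarrow> 0 - coset_rep D \<in> Q'"
      using additive_subgroup_minus[OF coweights.M] by (metis diff_0 minus_minus)
    thus "(\<Sum>C\<in>cosets P Q. e2pi (coset_rep D \<bullet> coset_rep C)) =
        (if D = coweights.coset 0 then of_nat (card (cosets P Q)) else 0)"
      using coweights.coset_rep_mem_iff[OF D zero(2)] weight_character_sum[OF coweights.coset_rep_in[OF D]]
      by simp
  qed
  also have "\<dots> = of_nat (card (cosets P Q))"
    using finite_coweight_cosets coweights.coset_in_cosets[OF zero(2)] by simp
  finally have "of_nat (card (cosets P Q)) = (of_nat (card (cosets P' Q')) :: complex)" using 1 by simp
  thus ?thesis by (simp only: of_nat_eq_iff)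
qed

text \<open>Orthogonality over \<open>P' / Q'\<close> keeps only the coset of \<open>\<nu>\<close>
  and produces the order of that group, while the transform divides by the order of
  \<open>P / Q\<close>; \<open>card_cosets_eq\<close> lets the two cancel.\<close>

lemma weight_fourier_inversion:
  assumes f: "f \<in> weight_class_functions \<Psi>" and \<nu>: "\<nu> \<in> P"
  shows "(\<Sum>D\<in>cosets P' Q'. weight_fourier \<Psi> f (coset_rep D) * e2pi (coset_rep D \<bullet> \<nu>)) = f \<nu>"
proof -
  define N where "N = card (cosets P Q)"
  have N: "N \<noteq> 0"
    unfolding N_def using finite_weight_cosets weights.coset_in_cosets[OF \<nu>] by auto
  have four: "weight_fourier \<Psi> f \<mu> = 1 / of_nat N * (\<Sum>C\<in>cosets P Q. f (coset_rep C) * e2pi (- (\<mu> \<bullet> coset_rep C)))" for \<mu>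
    by (simp add: weight_fourier_def N_def e2pi_def)
  have "(\<Sum>D\<in>cosets P' Q'. weight_fourier \<Psi> f (coset_rep D) * e2pi (coset_rep D \<bullet> \<nu>)) =
      (\<Sum>D\<in>cosets P' Q'. \<Sum>C\<in>cosets P Q. 1 / of_nat N * f (coset_rep C) * e2pi (coset_rep D \<bullet> (\<nu> - coset_rep C)))"
    unfolding four sum_distrib_left sum_distrib_right
    by (intro sum.cong refl) (simp add: inner_diff_right mult.assoc flip: e2pi_add)
  also have "\<dots> = (\<Sum>C\<in>cosets P Q. 1 / of_nat N * f (coset_rep C) *
      (\<Sum>D\<in>cosets P' Q'. e2pi (coset_rep D \<bullet> (\<nu> - coset_rep C))))"
    by (subst sum.swap) (simp add: sum_distrib_left)
  also have "\<dots> = (\<Sum>C\<in>cosets P Q. if C = weights.coset \<nu> then f \<nu> else 0)"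
  proof (intro sum.cong refl)
    fix C assume C: "C \<in> cosets P Q"
    have r: "coset_rep C \<in> P" by (rule weights.coset_rep_in[OF C])
    have "\<nu> - coset_rep C \<in> P" using r \<nu> weights.L by (simp add: additive_subgroup_def)
    hence "(\<Sum>D\<in>cosets P' Q'. e2pi (coset_rep D \<bullet> (\<nu> - coset_rep C))) = (if C = weights.coset \<nu> then of_nat N else 0)"
      by (simp add: coweight_character_sum weights.coset_rep_mem_iff[OF C \<nu>] N_def card_cosets_eq)
    moreover have "f (coset_rep C) = f \<nu>" if "C = weights.coset \<nu>"
    proof -
      have "\<nu> - coset_rep C \<in> Q" using that weights.coset_rep_mem_iff[OF C \<nu>] by (simp only:)
      thus ?thesis using f \<nu> r unfolding weight_class_functions_def by auto
    qed
    ultimately show "1 / of_nat N * f (coset_rep C) * (\<Sum>D\<in>cosets P' Q'. e2pi (coset_rep D \<bullet> (\<nu> - coset_rep C))) =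
        (if C = weights.coset \<nu> then f \<nu> else 0)"
      using N by simp
  qed
  also have "\<dots> = f \<nu>" using finite_weight_cosets weights.coset_in_cosets[OF \<nu>] by simp
  finally show ?thesis .
qed

end

section \<open>Comparison of the two sides\<close>

lemma has_sum_finite_sum:
  fixes g :: "'b \<Rightarrow> 'c \<Rightarrow> complex"
  assumes "\<And>i. i \<in> A \<Longrightarrow> (g i has_sum s i) X"
  shows "((\<lambda>x. \<Sum>i\<in>A. g i x) has_sum (\<Sum>i\<in>A. s i)) X"
  using assms by (induction A rule: infinite_finite_induct) (auto intro!: has_sum_add)

context root_basis
begin

text \<open>
  Since \<open>1 / 0 = 0\<close>, the following term vanishes on the singular weights, so sums over the regular
  weights may be extended to the whole weight lattice.
\<close>

definition weight_term :: "('a \<Rightarrow> nat) \<Rightarrow> 'a \<Rightarrow> 'a \<Rightarrow> complex" where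
  "weight_term k y \<nu> = e2pi (y \<bullet> \<nu>) * (\<Prod>\<alpha>\<in>\<Delta>p. 1 / of_real (coroot \<alpha> \<bullet> \<nu>) ^ k \<alpha>)"

section \<open>The Bernoulli side\<close>

lemma weight_coordinates:
  "bij_betw (\<lambda>m. \<Sum>\<beta>\<in>\<Psi>. of_int (m \<beta>) *\<^sub>R weight \<beta>) (\<Pi>\<^sub>E \<beta>\<in>\<Psi>. UNIV) P"
  unfolding bij_betw_def
proof
  show "inj_on (\<lambda>m. \<Sum>\<beta>\<in>\<Psi>. of_int (m \<beta>) *\<^sub>R weight \<beta>) (\<Pi>\<^sub>E \<beta>\<in>\<Psi>. UNIV)"
  proof (rule inj_onI)
    fix m m' :: "'a \<Rightarrow> int"
    assume m: "m \<in> (\<Pi>\<^sub>E \<beta>\<in>\<Psi>. UNIV)" "m' \<in> (\<Pi>\<^sub>E \<beta>\<in>\<Psi>. UNIV)"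
      and eq: "(\<Sum>\<beta>\<in>\<Psi>. of_int (m \<beta>) *\<^sub>R weight \<beta>) = (\<Sum>\<beta>\<in>\<Psi>. of_int (m' \<beta>) *\<^sub>R weight \<beta>)"
    show "m = m'"
    proof (rule PiE_ext[OF m])
      fix \<beta> assume "\<beta> \<in> \<Psi>"
      from dual_bases_inner_sum[OF dual_bases_sym[OF dual_coroot_weight] this]
      have "real_of_int (m \<beta>) = of_int (m' \<beta>)" using eq by metis
      thus "m \<beta> = m' \<beta>" by simp
    qed
  qed
  show "(\<lambda>m. \<Sum>\<beta>\<in>\<Psi>. of_int (m \<beta>) *\<^sub>R weight \<beta>) ` (\<Pi>\<^sub>E \<beta>\<in>\<Psi>. UNIV) = P"
  proof (intro equalityI subsetI)
    fix v assume "v \<in> P"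
    then obtain m :: "'a \<Rightarrow> int" where "v = (\<Sum>\<beta>\<in>\<Psi>. of_int (m \<beta>) *\<^sub>R weight \<beta>)"
      unfolding weight_lattice_def int_span_def by blast
    also have "\<dots> = (\<Sum>\<beta>\<in>\<Psi>. of_int (restrict m \<Psi> \<beta>) *\<^sub>R weight \<beta>)" by (intro sum.cong) auto
    finally have "v = (\<Sum>\<beta>\<in>\<Psi>. of_int (restrict m \<Psi> \<beta>) *\<^sub>R weight \<beta>)" .
    moreover have "restrict m \<Psi> \<in> (\<Pi>\<^sub>E \<beta>\<in>\<Psi>. UNIV)" by simp
    ultimately show "v \<in> (\<lambda>m. \<Sum>\<beta>\<in>\<Psi>. of_int (m \<beta>) *\<^sub>R weight \<beta>) ` (\<Pi>\<^sub>E \<beta>\<in>\<Psi>. UNIV)"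
      by blast
  qed (auto simp: weight_lattice_def int_span_def)
qed

text \<open>The two kinds of denominators in the cube integral, coordinates at simple roots and
  integer combinations at the other positive roots, are both
  \<open>coroot \<alpha> \<bullet> \<nu>\<close> and merge into one product.\<close>

lemma has_sum_root_bernoulli:
  assumes k: "\<forall>\<alpha>\<in>\<Delta>p. k \<alpha> \<ge> 2"
  shows "((\<lambda>\<nu>. (\<Prod>\<alpha>\<in>\<Delta>p. bernoulli_scale (k \<alpha>)) * weight_term k y \<nu>) has_sum
           of_real (root_bernoulli \<Delta> \<Psi> k y)) P"
proof -
  define I where "I = \<Delta>p - \<Psi>"
  \<comment> \<open>The floor is exact on positive roots by \<open>coroot_weight_Ints\<close>; it
    supplies the matrix of integer type that the cube integral asks for.\<close>
  define a where "a \<alpha> \<beta> = \<lfloor>coroot \<alpha> \<bullet> weight \<beta>\<rfloor>" for \<alpha> \<beta>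
  have a: "of_int (a \<alpha> \<beta>) = coroot \<alpha> \<bullet> weight \<beta>" if "\<alpha> \<in> I" "\<beta> \<in> \<Psi>" for \<alpha> \<beta>
    using coroot_weight_Ints[of \<alpha> \<beta>] that positive_root by (auto simp: a_def I_def elim: Ints_cases)
  have split: "\<Delta>p = I \<union> \<Psi>" "I \<inter> \<Psi> = {}" "finite I"
    using simple_positive finite_positive by (auto simp: I_def)
  have prod_split: "(\<Prod>\<alpha>\<in>\<Delta>p. g \<alpha>) = (\<Prod>\<alpha>\<in>I. g \<alpha>) * (\<Prod>\<alpha>\<in>\<Psi>. g \<alpha>)" for g :: "'a \<Rightarrow> complex"
    unfolding split(1) using split finite_simple by (intro prod.union_disjoint) auto
  have rb: "root_bernoulli \<Delta> \<Psi> k y = (LINT x : (\<Pi>\<^sub>E \<alpha>\<in>I. {0..1}) | (\<Pi>\<^sub>M \<alpha>\<in>I. lborel).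
        (\<Prod>\<alpha>\<in>I. bernoulli_poly (k \<alpha>) (x \<alpha>)) *
        (\<Prod>\<beta>\<in>\<Psi>. bernoulli_poly (k \<beta>) (frac (y \<bullet> weight \<beta> - (\<Sum>\<alpha>\<in>I. x \<alpha> * of_int (a \<alpha> \<beta>))))))"
    unfolding root_bernoulli_def Let_def I_def[symmetric] by (simp add: a cong: sum.cong prod.cong)
  show ?thesis
  proof (subst has_sum_reindex_bij_betw[OF weight_coordinates, symmetric], unfold rb,
      rule has_sum_cong[THEN iffD1, OF _ has_sum_unit_cube_bernoulli])
    fix m :: "'a \<Rightarrow> int"
    define v where "v = (\<Sum>\<beta>\<in>\<Psi>. of_int (m \<beta>) *\<^sub>R weight \<beta>)"
    have "y \<bullet> v = (\<Sum>\<beta>\<in>\<Psi>. of_int (m \<beta>) * (y \<bullet> weight \<beta>))"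
      by (simp add: v_def inner_sum_right)
    moreover have "(\<Prod>\<beta>\<in>\<Psi>. 1 / of_int (m \<beta>) ^ k \<beta>) = (\<Prod>\<beta>\<in>\<Psi>. 1 / complex_of_real (coroot \<beta> \<bullet> v) ^ k \<beta>)"
    proof (intro prod.cong refl)
      fix \<beta> assume "\<beta> \<in> \<Psi>"
      from dual_bases_inner_sum[OF dual_bases_sym[OF dual_coroot_weight] this]
      show "1 / of_int (m \<beta>) ^ k \<beta> = 1 / complex_of_real (coroot \<beta> \<bullet> v) ^ k \<beta>" by (simp add: v_def)
    qed
    moreover have "(\<Prod>\<alpha>\<in>I. 1 / of_int (\<Sum>\<beta>\<in>\<Psi>. m \<beta> * a \<alpha> \<beta>) ^ k \<alpha>) =
        (\<Prod>\<alpha>\<in>I. 1 / complex_of_real (coroot \<alpha> \<bullet> v) ^ k \<alpha>)"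
    proof (intro prod.cong refl)
      fix \<alpha> assume "\<alpha> \<in> I"
      hence "real_of_int (\<Sum>\<beta>\<in>\<Psi>. m \<beta> * a \<alpha> \<beta>) = coroot \<alpha> \<bullet> v"
        by (simp add: v_def inner_sum_right a)
      thus "1 / of_int (\<Sum>\<beta>\<in>\<Psi>. m \<beta> * a \<alpha> \<beta>) ^ k \<alpha> = 1 / complex_of_real (coroot \<alpha> \<bullet> v) ^ k \<alpha>"
        by (metis of_real_of_int_eq)
    qed
    ultimately show "(\<Prod>\<alpha>\<in>I. bernoulli_scale (k \<alpha>)) * (\<Prod>\<beta>\<in>\<Psi>. bernoulli_scale (k \<beta>)) *
             (e2pi (\<Sum>\<beta>\<in>\<Psi>. of_int (m \<beta>) * (y \<bullet> weight \<beta>)) * (\<Prod>\<beta>\<in>\<Psi>. 1 / of_int (m \<beta>) ^ k \<beta>) *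
             (\<Prod>\<alpha>\<in>I. 1 / of_int (\<Sum>\<beta>\<in>\<Psi>. m \<beta> * a \<alpha> \<beta>) ^ k \<alpha>)) =
        (\<Prod>\<alpha>\<in>\<Delta>p. bernoulli_scale (k \<alpha>)) * weight_term k y (\<Sum>\<beta>\<in>\<Psi>. of_int (m \<beta>) *\<^sub>R weight \<beta>)"
      by (simp only: weight_term_def prod_split v_def[symmetric] mult_ac)
  qed (use k split simple_positive finite_simple in auto)
qed

text \<open>Moving \<open>y\<close> by \<mu> multiplies the term at \<open>\<nu>\<close> by
  \<open>e2pi (\<mu> \<bullet> \<nu>)\<close>, so the twisted combination is the inverse Fourier
  transform evaluated at \<open>\<nu>\<close>.\<close>

lemma has_sum_root_bernoulli_twisted:
  assumes k: "\<forall>\<alpha>\<in>\<Delta>p. k \<alpha> \<ge> 2" and f: "f \<in> weight_class_functions \<Psi>"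
  shows "((\<lambda>\<nu>. f \<nu> * weight_term k y \<nu>) has_sum
           (-1) ^ card \<Delta>p * (\<Prod>\<alpha>\<in>\<Delta>p. (2 * of_real pi * \<i>) ^ k \<alpha> / fact (k \<alpha>)) *
           root_bernoulli_twisted \<Delta> \<Psi> k y f) P"
proof -
  let ?c = "(-1) ^ card \<Delta>p * (\<Prod>\<alpha>\<in>\<Delta>p. (2 * of_real pi * \<i>) ^ k \<alpha> / fact (k \<alpha>)) :: complex"
  let ?s = "\<Prod>\<alpha>\<in>\<Delta>p. bernoulli_scale (k \<alpha>)"
  \<comment> \<open>Distributing (-1)^n over the roots matches the minus sign in each
    \<open>bernoulli_scale\<close>.\<close>
  have "?c = (\<Prod>\<alpha>\<in>\<Delta>p. - ((2 * of_real pi * \<i>) ^ k \<alpha> / fact (k \<alpha>)))"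
    by (simp add: prod_uminus)
  hence cs: "?c * ?s = 1"
    unfolding prod.distrib[symmetric] bernoulli_scale_def by (simp flip: prod.distrib)
  have "((\<lambda>\<nu>. \<Sum>D\<in>cosets P' Q'. weight_fourier \<Psi> f (coset_rep D) * (?s * weight_term k (y + coset_rep D) \<nu>))
      has_sum root_bernoulli_twisted \<Delta> \<Psi> k y f) P"
    unfolding root_bernoulli_twisted_def
    by (intro has_sum_finite_sum has_sum_cmult_right has_sum_root_bernoulli k)
  hence "((\<lambda>\<nu>. ?c * (\<Sum>D\<in>cosets P' Q'. weight_fourier \<Psi> f (coset_rep D) * (?s * weight_term k (y + coset_rep D) \<nu>)))
      has_sum ?c * root_bernoulli_twisted \<Delta> \<Psi> k y f) P"
    by (rule has_sum_cmult_right)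
  moreover have "?c * (\<Sum>D\<in>cosets P' Q'. weight_fourier \<Psi> f (coset_rep D) * (?s * weight_term k (y + coset_rep D) \<nu>)) =
      f \<nu> * weight_term k y \<nu>" if "\<nu> \<in> P" for \<nu>
  proof -
    have "weight_term k (y + \<mu>) \<nu> = e2pi (\<mu> \<bullet> \<nu>) * weight_term k y \<nu>" for \<mu>
      by (simp add: weight_term_def inner_add_left e2pi_add)
    hence "?c * (\<Sum>D\<in>cosets P' Q'. weight_fourier \<Psi> f (coset_rep D) * (?s * weight_term k (y + coset_rep D) \<nu>)) =
        (?c * ?s) * (\<Sum>D\<in>cosets P' Q'. weight_fourier \<Psi> f (coset_rep D) * e2pi (coset_rep D \<bullet> \<nu>)) * weight_term k y \<nu>"
      by (simp only: sum_distrib_left sum_distrib_right mult_ac)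
    thus ?thesis by (simp only: cs weight_fourier_inversion[OF f that] mult_1)
  qed
  ultimately show ?thesis by (subst (asm) has_sum_cong)
qed

section \<open>The zeta side\<close>

text \<open>\<open>w\<close> permutes the pairs {\<alpha>, -\<alpha>}, each of which has one
  positive member. Two positive roots in one pair coincide, and injectivity on a finite set
  suffices.\<close>

lemma weyl_positive_bij:
  assumes w: "w \<in> W"
  shows "bij_betw (\<lambda>\<alpha>. if w \<alpha> \<in> \<Delta>n then - w \<alpha> else w \<alpha>) \<Delta>p \<Delta>p"
proof -
  let ?p = "\<lambda>\<alpha>. if w \<alpha> \<in> \<Delta>n then - w \<alpha> else w \<alpha>"
  have wneg: "w (- \<alpha>) = - w \<alpha>" for \<alpha> using weyl_linear[OF w] by (rule linear_neg)
  have sub: "?p ` \<Delta>p \<subseteq> \<Delta>p"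
    using weyl_root[OF w positive_root] roots_split negative_iff by auto
  have "inj_on ?p \<Delta>p"
  proof (rule inj_onI)
    fix \<alpha> \<gamma> assume *: "\<alpha> \<in> \<Delta>p" "\<gamma> \<in> \<Delta>p" "?p \<alpha> = ?p \<gamma>"
    hence "w \<alpha> = w \<gamma> \<or> w \<alpha> = w (- \<gamma>)" unfolding wneg by (metis minus_minus)
    hence "\<alpha> = \<gamma> \<or> \<alpha> = - \<gamma>" using weyl_bij[OF w] by (metis bij_is_inj injD)
    thus "\<alpha> = \<gamma>" using * positive_not_negative[of \<alpha>] negative_iff by auto
  qed
  thus ?thesis unfolding bij_betw_def using endo_inj_surj[OF finite_positive sub] by blast
qed

text \<open>All bases are positive, so the complex powers are ordinary ones. Reindexing by the
  positive one of the roots \<plusminus>w \<alpha> makes the linear forms pair with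
  \<open>w \<nu>\<close>, at the price of a sign wherever the root was flipped.\<close>

lemma weyl_zeta_term:
  assumes w: "w \<in> W" and \<nu>: "\<nu> \<in> strictly_dominant_weights \<Psi>" and f: "f \<in> weight_class_functions \<Psi>"
  shows "(\<Prod>\<alpha>\<in>\<Delta>p \<inter> w ` \<Delta>n. (-1) ^ k \<alpha>) *
      (f \<nu> * exp (2 * of_real pi * \<i> * of_real (inv_into UNIV w y \<bullet> \<nu>)) *
       (\<Prod>\<alpha>\<in>\<Delta>p. of_real (coroot \<alpha> \<bullet> \<nu>) powr (- weyl_inv_act \<Delta> \<Psi> w (\<lambda>\<alpha>. of_nat (k \<alpha>)) \<alpha>))) =
      f (w \<nu>) * weight_term k y (w \<nu>)"
proof -
  let ?p = "\<lambda>\<alpha>. if w \<alpha> \<in> \<Delta>n then - w \<alpha> else w \<alpha>"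
  \<comment> \<open>On \<open>\<Delta>p\<close> this is the sign of
    \<open>coroot \<gamma> \<bullet> w \<nu>\<close>: negative exactly on the image of
    \<open>\<Delta>n\<close> under \<open>w\<close>.\<close>
  define \<epsilon> where "\<epsilon> \<gamma> = (if \<gamma> \<in> w ` \<Delta>n then -1 else 1 :: complex)" for \<gamma>
  have \<nu>P: "\<nu> \<in> P" using \<nu> by (simp add: strictly_dominant_iff)
  have wneg: "w (- \<alpha>) = - w \<alpha>" for \<alpha> using weyl_linear[OF w] by (rule linear_neg)
  have "(\<Prod>\<alpha>\<in>\<Delta>p. of_real (coroot \<alpha> \<bullet> \<nu>) powr (- weyl_inv_act \<Delta> \<Psi> w (\<lambda>\<alpha>. of_nat (k \<alpha>)) \<alpha>)) =
      (\<Prod>\<alpha>\<in>\<Delta>p. \<epsilon> (?p \<alpha>) ^ k (?p \<alpha>) * (1 / complex_of_real (coroot (?p \<alpha>) \<bullet> w \<nu>) ^ k (?p \<alpha>)))"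
  proof (intro prod.cong refl)
    fix \<alpha> assume \<alpha>: "\<alpha> \<in> \<Delta>p"
    have pos: "coroot \<alpha> \<bullet> \<nu> > 0" by (rule coroot_strictly_dominant_pos[OF \<alpha> \<nu>])
    have act: "weyl_inv_act \<Delta> \<Psi> w (\<lambda>\<alpha>. of_nat (k \<alpha>)) \<alpha> = (of_nat (k (?p \<alpha>)) :: complex)"
      by (simp add: weyl_inv_act_def)
    have eps: "\<epsilon> (?p \<alpha>) = (if w \<alpha> \<in> \<Delta>n then -1 else 1)"
    proof (cases "w \<alpha> \<in> \<Delta>n")
      case True
      have "- w \<alpha> \<in> w ` \<Delta>n" using \<alpha> negative_iff wneg by (metis imageI minus_minus)
      thus ?thesis using True by (simp add: \<epsilon>_def)
    next
      case False
      have "w \<alpha> \<notin> w ` \<Delta>n" 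
        using positive_not_negative[OF \<alpha>] weyl_bij[OF w] by (simp add: inj_image_mem_iff bij_is_inj)
      thus ?thesis using False by (simp add: \<epsilon>_def)
    qed
    have "coroot (w \<alpha>) \<bullet> w \<nu> = coroot \<alpha> \<bullet> \<nu>"
      by (simp add: coroot_orthogonal[OF weyl_orthogonal[OF w]] weyl_inner[OF w])
    hence cor: "complex_of_real (coroot \<alpha> \<bullet> \<nu>) = \<epsilon> (?p \<alpha>) * of_real (coroot (?p \<alpha>) \<bullet> w \<nu>)"
      unfolding eps by (simp add: coroot_minus)
    have "complex_of_real (coroot \<alpha> \<bullet> \<nu>) powr (- of_nat (k (?p \<alpha>))) = 1 / of_real (coroot \<alpha> \<bullet> \<nu>) ^ k (?p \<alpha>)"
      using pos by (simp add: powr_minus powr_nat inverse_eq_divide)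
    also have "\<dots> = \<epsilon> (?p \<alpha>) ^ k (?p \<alpha>) * (1 / complex_of_real (coroot (?p \<alpha>) \<bullet> w \<nu>) ^ k (?p \<alpha>))"
    proof -
      have "1 / \<epsilon> \<gamma> ^ n = \<epsilon> \<gamma> ^ n" for \<gamma> n by (simp add: \<epsilon>_def flip: power_one_over)
      thus ?thesis unfolding cor power_mult_distrib by (metis mult_1 times_divide_times_eq)
    qed
    finally show "of_real (coroot \<alpha> \<bullet> \<nu>) powr (- weyl_inv_act \<Delta> \<Psi> w (\<lambda>\<alpha>. of_nat (k \<alpha>)) \<alpha>) =
        \<epsilon> (?p \<alpha>) ^ k (?p \<alpha>) * (1 / complex_of_real (coroot (?p \<alpha>) \<bullet> w \<nu>) ^ k (?p \<alpha>))"
      unfolding act .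
  qed
  also have "\<dots> = (\<Prod>\<gamma>\<in>\<Delta>p. \<epsilon> \<gamma> ^ k \<gamma> * (1 / complex_of_real (coroot \<gamma> \<bullet> w \<nu>) ^ k \<gamma>))"
    by (rule prod.reindex_bij_betw[OF weyl_positive_bij[OF w]])
  also have "\<dots> = (\<Prod>\<gamma>\<in>\<Delta>p. \<epsilon> \<gamma> ^ k \<gamma>) * (\<Prod>\<gamma>\<in>\<Delta>p. 1 / complex_of_real (coroot \<gamma> \<bullet> w \<nu>) ^ k \<gamma>)"
    by (rule prod.distrib)
  also have "(\<Prod>\<gamma>\<in>\<Delta>p. \<epsilon> \<gamma> ^ k \<gamma>) = (\<Prod>\<alpha>\<in>\<Delta>p \<inter> w ` \<Delta>n. (-1) ^ k \<alpha>)"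
    using finite_positive by (intro prod.mono_neutral_cong_right) (auto simp: \<epsilon>_def)
  finally have prod_eq: "(\<Prod>\<alpha>\<in>\<Delta>p. of_real (coroot \<alpha> \<bullet> \<nu>) powr (- weyl_inv_act \<Delta> \<Psi> w (\<lambda>\<alpha>. of_nat (k \<alpha>)) \<alpha>)) =
      (\<Prod>\<alpha>\<in>\<Delta>p \<inter> w ` \<Delta>n. (-1) ^ k \<alpha>) * (\<Prod>\<gamma>\<in>\<Delta>p. 1 / complex_of_real (coroot \<gamma> \<bullet> w \<nu>) ^ k \<gamma>)" .
  \<comment> \<open>The prefactor of the statement and the signs produced by the reindexing are the
    same product, and its square is 1.\<close>
  have sq: "(\<Prod>\<alpha>\<in>\<Delta>p \<inter> w ` \<Delta>n. (-1) ^ k \<alpha>) * (\<Prod>\<alpha>\<in>\<Delta>p \<inter> w ` \<Delta>n. (-1) ^ k \<alpha>) = (1::complex)"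
    by (simp flip: prod.distrib power_mult_distrib)
  have "f (w \<nu>) = f \<nu>"
    using f weyl_weight_diff[OF w \<nu>P] \<nu>P unfolding weight_class_functions_def by blast
  moreover have "exp (2 * of_real pi * \<i> * of_real (inv_into UNIV w y \<bullet> \<nu>)) = e2pi (y \<bullet> w \<nu>)"
    by (simp add: e2pi_def weyl_inv_inner[OF w])
  ultimately show ?thesis
    unfolding prod_eq weight_term_def using sq by (simp add: mult_ac)
qed

text \<open>Each \<open>w\<close> accounts for one chamber. Summability there is inherited from the
  sum over \<open>P\<close>, so the finitely many disjoint chamber sums may be joined.\<close>

lemma weyl_zeta_sum:
  assumes f: "f \<in> weight_class_functions \<Psi>" and S: "((\<lambda>\<nu>. f \<nu> * weight_term k y \<nu>) has_sum S) P"
    and k: "\<forall>\<alpha>\<in>\<Delta>p. k \<alpha> \<ge> 2"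
  shows "(\<Sum>w\<in>W. (\<Prod>\<alpha>\<in>\<Delta>p \<inter> w ` \<Delta>n. (-1) ^ k \<alpha>) *
            root_zeta \<Delta> \<Psi> (weyl_inv_act \<Delta> \<Psi> w (\<lambda>\<alpha>. of_nat (k \<alpha>))) (inv_into UNIV w y) f) = S"
proof -
  let ?D = "strictly_dominant_weights \<Psi>"
  let ?G = "\<lambda>\<nu>. f \<nu> * weight_term k y \<nu>"
  have "(\<Prod>\<alpha>\<in>\<Delta>p \<inter> w ` \<Delta>n. (-1) ^ k \<alpha>) *
            root_zeta \<Delta> \<Psi> (weyl_inv_act \<Delta> \<Psi> w (\<lambda>\<alpha>. of_nat (k \<alpha>))) (inv_into UNIV w y) f =
        infsum ?G (w ` ?D)" if w: "w \<in> W" for w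
  proof -
    have "inj_on w ?D" using weyl_bij[OF w] by (meson bij_is_inj inj_on_subset subset_UNIV)
    hence "infsum ?G (w ` ?D) = (\<Sum>\<^sub>\<infinity>\<nu>\<in>?D. ?G (w \<nu>))"
      by (subst infsum_reindex) (simp_all add: o_def)
    also have "\<dots> = (\<Sum>\<^sub>\<infinity>\<nu>\<in>?D. (\<Prod>\<alpha>\<in>\<Delta>p \<inter> w ` \<Delta>n. (-1) ^ k \<alpha>) *
      (f \<nu> * exp (2 * of_real pi * \<i> * of_real (inv_into UNIV w y \<bullet> \<nu>)) *
       (\<Prod>\<alpha>\<in>\<Delta>p. of_real (coroot \<alpha> \<bullet> \<nu>) powr (- weyl_inv_act \<Delta> \<Psi> w (\<lambda>\<alpha>. of_nat (k \<alpha>)) \<alpha>))))"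
      by (intro infsum_cong weyl_zeta_term[symmetric] w f)
    finally show ?thesis unfolding root_zeta_def by (simp only: infsum_cmult_right')
  qed
  hence "(\<Sum>w\<in>W. (\<Prod>\<alpha>\<in>\<Delta>p \<inter> w ` \<Delta>n. (-1) ^ k \<alpha>) *
            root_zeta \<Delta> \<Psi> (weyl_inv_act \<Delta> \<Psi> w (\<lambda>\<alpha>. of_nat (k \<alpha>))) (inv_into UNIV w y) f) =
      (\<Sum>w\<in>W. infsum ?G (w ` ?D))"
    by (intro sum.cong refl)
  also have sub: "w ` ?D \<subseteq> P" if "w \<in> W" for w
    using weyl_weight_diff(2)[OF that] by (auto simp: strictly_dominant_iff)
  have "(\<Sum>w\<in>W. infsum ?G (w ` ?D)) = infsum ?G (\<Union>w\<in>W. w ` ?D)"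
  proof (rule sum_infsum[OF finite_weyl])
    show "?G summable_on w ` ?D" if "w \<in> W" for w
      using has_sum_imp_summable[OF S] sub[OF that] by (rule summable_on_subset_banach)
    show "w ` ?D \<inter> w' ` ?D = {}" if "w \<in> W" "w' \<in> W" "w \<noteq> w'" for w w'
      using weyl_chamber_inj[OF that(1,2)] that(3) by blast
  qed
  also have "\<dots> = infsum ?G P"
  proof (rule infsum_cong_neutral)
    fix v assume v: "v \<in> P - (\<Union>w\<in>W. w ` ?D)"
    then obtain \<alpha> where \<alpha>: "\<alpha> \<in> \<Delta>p" "coroot \<alpha> \<bullet> v = 0"
      using weyl_chamber_surj[of v] by blast
    \<comment> \<open>A positive exponent is what makes the factor \<open>1 / 0 ^ k \<alpha>\<close>
      equal to 0 rather than 1.\<close>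
    moreover have "k \<alpha> > 0" using k \<alpha>(1) by fastforce
    ultimately show "?G v = 0"
      using finite_positive by (auto simp: weight_term_def intro!: bexI[of _ \<alpha>])
  qed (use sub in auto)
  also have "\<dots> = S" using S by (rule infsumI)
  finally show ?thesis .
qed

end

theorem theorem2p25:
  fixes \<Delta> \<Psi> :: "'a::euclidean_space set"
    and k :: "'a \<Rightarrow> nat" and y :: 'a and f :: "'a \<Rightarrow> complex"
  assumes "reduced_root_system \<Delta>"
    and "fundamental_system \<Delta> \<Psi>"
    and "\<forall>\<alpha>\<in>positive_roots \<Delta> \<Psi>. k \<alpha> \<ge> 2"
    and "f \<in> weight_class_functions \<Psi>"
  shows "(\<Sum>w\<in>weyl_group \<Delta>.
            (\<Prod>\<alpha>\<in>positive_roots \<Delta> \<Psi> \<inter> w ` negative_roots \<Delta> \<Psi>. (-1) ^ k \<alpha>) *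
            root_zeta \<Delta> \<Psi> (weyl_inv_act \<Delta> \<Psi> w (\<lambda>\<alpha>. of_nat (k \<alpha>))) (inv_into UNIV w y) f)
       = (-1) ^ card (positive_roots \<Delta> \<Psi>) *
         (\<Prod>\<alpha>\<in>positive_roots \<Delta> \<Psi>. (2 * of_real pi * \<i>) ^ k \<alpha> / fact (k \<alpha>)) *
         root_bernoulli_twisted \<Delta> \<Psi> k y f"
proof -
  interpret root_basis \<Delta> \<Psi> using assms(1,2) by unfold_locales
  show ?thesis
    by (rule weyl_zeta_sum[OF assms(4) has_sum_root_bernoulli_twisted[OF assms(3,4)] assms(3)])
qed

end
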